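(* Let $0\le q\in L_1^{\mathrm{loc}}(\mathbb R)$ satisfy $\int_{-\infty}^x q(t)\,dt>0$ and $\int_x^\infty q(t)\,dt>0$ for all $x\in\mathbb R$. Let $\mu,\theta$ be positive continuous functions on $\mathbb R$, let $p\in[1,\infty)$, and suppose that $$\int_{-\infty}^0\mu(t)\,dt=\int_0^\infty\mu(t)\,dt=\infty.$$ Then the pair $\{L_{p,\mu};L_{p,\theta}\}$ is admissible for the equation $$-y''(x)+q(x)y(x)=f(x),\quad x\in\mathbb R,$$ if and only if the operator $S:L_p(\mathbb R)\to L_p(\mathbb R)$, $$(Sf)(x)=\mu(x)\int_{-\infty}^\infty\frac{G(x,t)}{\theta(t)}f(t)\,dt,\quad x\in\mathbb R,\ f\in L_p(\mathbb R),$$ is bounded, where $G(x,t)$ is the Green function of the equation.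
   Context: $L_{p,\mu}=\{f\in L_p^{\mathrm{loc}}(\mathbb R):\|f\|_{p,\mu}^p=\int_{-\infty}^\infty|\mu(x)f(x)|^pdx<\infty\}$, and $L_{p,\theta}$, $\|\cdot\|_{p,\theta}$ are defined in the same way with $\theta$ in place of $\mu$. A solution of $-y''+qy=f$ (with $f\in L_p^{\mathrm{loc}}(\mathbb R)$) is a function $y$ which is (locally) absolutely continuous together with its derivative and satisfies the equation almost everywhere on $\mathbb R$. The pair $\{L_{p,\mu};L_{p,\theta}\}$ is called admissible for the equation if: (I) for every $f\in L_{p,\theta}$ there is a unique solution $y\in L_{p,\mu}$ of the equation; (II) there is a constant $c(p)\in(0,\infty)$ such that for every $f\in L_{p,\theta}$ the solution $y\in L_{p,\mu}$ satisfies $\|y\|_{p,\mu}\le c(p)\|f\|_{p,\theta}$. Green function: under the stated assumptions on $q$, it is known that the equation $z''=qz$ on $\mathbb R$ has a fundamental system of solutions $\{u,v\}$ such that, for all $x\in\mathbb R$, $u(x)>0$, $v(x)>0$, $u'(x)<0$, $v'(x)>0$, $v'(x)u(x)-u'(x)v(x)=1$, $\lim_{x\to-\infty}v(x)/u(x)=\lim_{x\to\infty}u(x)/v(x)=0$, and $|(uv)'(x)|<1$. Then $G(x,t)=u(x)v(t)$ for $x\ge t$ and $G(x,t)=u(t)v(x)$ for $x\le t$. *)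

theory Defs
  imports "HOL-Analysis.Analysis"
begin

definition L1_loc :: "(real \<Rightarrow> real) set" where
  "L1_loc = {f. \<forall>a b. f absolutely_integrable_on {a..b}}"

text \<open>Elements of the \<open>L\<close>-spaces are represented by functions, not by classes modulo null sets.\<close>

definition Lp_loc :: "real \<Rightarrow> (real \<Rightarrow> real) set" where
  "Lp_loc p = {f. f \<in> borel_measurable lebesgue \<and>
     (\<forall>a b. (\<lambda>x. \<bar>f x\<bar> powr p) absolutely_integrable_on {a..b})}"

definition Lp :: "real \<Rightarrow> (real \<Rightarrow> real) set" where
  "Lp p = {f. f \<in> borel_measurable lebesgue \<and> integrable lebesgue (\<lambda>x. \<bar>f x\<bar> powr p)}"

definition Lp_norm :: "real \<Rightarrow> (real \<Rightarrow> real) \<Rightarrow> real" where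
  "Lp_norm p f = (LINT x|lebesgue. \<bar>f x\<bar> powr p) powr (1 / p)"

definition Lp_weighted :: "real \<Rightarrow> (real \<Rightarrow> real) \<Rightarrow> (real \<Rightarrow> real) set" where
  "Lp_weighted p w =
     {f \<in> Lp_loc p. integrable lebesgue (\<lambda>x. \<bar>w x * f x\<bar> powr p)}"

definition Lp_weighted_norm :: "real \<Rightarrow> (real \<Rightarrow> real) \<Rightarrow> (real \<Rightarrow> real) \<Rightarrow> real" where
  "Lp_weighted_norm p w f = Lp_norm p (\<lambda>x. w x * f x)"

text \<open>
  Absolute continuity on \<open>[a, b]\<close> in the usual epsilon-delta form: a finite family of
  non-overlapping closed subintervals \<open>[Inf K, Sup K]\<close> is a division of its union \<open>T\<close>.
\<close>

definition abs_continuous_on_interval :: "(real \<Rightarrow> real) \<Rightarrow> real \<Rightarrow> real \<Rightarrow> bool" where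
  "abs_continuous_on_interval f a b \<longleftrightarrow>
     (\<forall>\<epsilon>>0. \<exists>\<delta>>0. \<forall>\<D> T. \<D> division_of T \<longrightarrow> T \<subseteq> {a..b} \<longrightarrow>
        (\<Sum>K\<in>\<D>. Sup K - Inf K) < \<delta> \<longrightarrow> (\<Sum>K\<in>\<D>. \<bar>f (Sup K) - f (Inf K)\<bar>) < \<epsilon>)"

definition loc_abs_continuous :: "(real \<Rightarrow> real) \<Rightarrow> bool" where
  "loc_abs_continuous f \<longleftrightarrow> (\<forall>a b. abs_continuous_on_interval f a b)"

text \<open>The second derivative exists only almost everywhere, so its existence at \<open>x\<close> is part of
  the equation holding at \<open>x\<close>.\<close>

definition is_solution :: "(real \<Rightarrow> real) \<Rightarrow> (real \<Rightarrow> real) \<Rightarrow> (real \<Rightarrow> real) \<Rightarrow> bool" where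
  "is_solution q f y \<longleftrightarrow>
     (\<forall>x. y differentiable at x) \<and>
     loc_abs_continuous y \<and> loc_abs_continuous (deriv y) \<and>
     (AE x in lebesgue. deriv y differentiable at x \<and> - deriv (deriv y) x + q x * y x = f x)"

definition admissible ::
  "real \<Rightarrow> (real \<Rightarrow> real) \<Rightarrow> (real \<Rightarrow> real) \<Rightarrow> (real \<Rightarrow> real) \<Rightarrow> bool" where
  "admissible p \<mu> \<theta> q \<longleftrightarrow>
     (\<forall>f \<in> Lp_weighted p \<theta>. \<exists>!y. y \<in> Lp_weighted p \<mu> \<and> is_solution q f y) \<and>
     (\<exists>c>0. \<forall>f \<in> Lp_weighted p \<theta>. \<forall>y \<in> Lp_weighted p \<mu>. is_solution q f y \<longrightarrow>
        Lp_weighted_norm p \<mu> y \<le> c * Lp_weighted_norm p \<theta> f)"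

text \<open>Linear independence of \<open>u\<close> and \<open>v\<close> is contained in the Wronskian being \<open>1\<close>.\<close>

definition principal_system ::
  "(real \<Rightarrow> real) \<Rightarrow> (real \<Rightarrow> real) \<Rightarrow> (real \<Rightarrow> real) \<Rightarrow> bool" where
  "principal_system q u v \<longleftrightarrow>
     is_solution q (\<lambda>_. 0) u \<and> is_solution q (\<lambda>_. 0) v \<and>
     (\<forall>x. u x > 0 \<and> v x > 0 \<and> deriv u x < 0 \<and> deriv v x > 0 \<and>
          deriv v x * u x - deriv u x * v x = 1 \<and>
          \<bar>deriv (\<lambda>s. u s * v s) x\<bar> < 1) \<and>
     ((\<lambda>x. v x / u x) \<longlongrightarrow> 0) at_bot \<and>
     ((\<lambda>x. u x / v x) \<longlongrightarrow> 0) at_top"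

text \<open>The conditions on \<open>u\<close> and \<open>v\<close> determine them up to \<open>(u, v) \<mapsto> (c u, v / c)\<close> with
  \<open>c > 0\<close>, so at most one \<open>G\<close> satisfies the following predicate.\<close>

definition is_green_function ::
  "(real \<Rightarrow> real) \<Rightarrow> (real \<Rightarrow> real \<Rightarrow> real) \<Rightarrow> bool" where
  "is_green_function q G \<longleftrightarrow>
     (\<exists>u v. principal_system q u v \<and>
        G = (\<lambda>x t. if x \<ge> t then u x * v t else u t * v x))"

definition green_operator ::
  "(real \<Rightarrow> real) \<Rightarrow> (real \<Rightarrow> real) \<Rightarrow> (real \<Rightarrow> real \<Rightarrow> real) \<Rightarrow> (real \<Rightarrow> real) \<Rightarrow> real \<Rightarrow> real" where
  "green_operator \<mu> \<theta> G f x = \<mu> x * (LINT t|lebesgue. G x t / \<theta> t * f t)"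

text \<open>The integral is \<open>0\<close> by convention when the integrand is not integrable, so convergence
  of the defining integral has to be required separately.\<close>

definition green_operator_bounded ::
  "real \<Rightarrow> (real \<Rightarrow> real) \<Rightarrow> (real \<Rightarrow> real) \<Rightarrow> (real \<Rightarrow> real \<Rightarrow> real) \<Rightarrow> bool" where
  "green_operator_bounded p \<mu> \<theta> G \<longleftrightarrow>
     (\<forall>f \<in> Lp p. (AE x in lebesgue. integrable lebesgue (\<lambda>t. G x t / \<theta> t * f t)) \<and>
        green_operator \<mu> \<theta> G f \<in> Lp p) \<and>
     (\<exists>C. \<forall>f \<in> Lp p. Lp_norm p (green_operator \<mu> \<theta> G f) \<le> C * Lp_norm p f)"

end

theory Submission
  imports Defs
begin

text \<open>
  Variation of constants shows that \<open>y x = \<integral> G x t * f t dt\<close> solves the equation whenever the integral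
  converges. Since \<open>u\<close> and \<open>v\<close> are convex and monotone, they grow at least linearly at \<open>-\<infinity>\<close> and \<open>\<infinity>\<close>,
  respectively, and Hoelder's inequality together with the divergence of both integrals of \<open>\<mu>\<close> keeps
  functions of linear growth at either end out of the weighted space; hence the homogeneous
  equation has no nonzero solution there. This gives admissibility from boundedness. Conversely, for
  \<open>f \<ge> 0\<close> of compact support the same growth argument identifies the weighted solution with the
  Green integral, and monotone convergence transfers the bound to all \<open>f \<ge> 0\<close>.
\<close>

section \<open>Locally absolutely continuous functions\<close>

text \<open>The equation holds only almost everywhere, with an absolutely continuous derivative, so
  each passage between a function and its derivative rests on two facts: an absolutely continuous
  function is the integral of its almost everywhere derivative, and an indefinite integral has its
  integrand as derivative almost everywhere. Both are obtained with gauge integrals, the second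
  through Henstock's lemma and Vitali's covering theorem. The delicate point of the converse is
  convergence: admissibility says nothing about the integral that defines the operator, and the
  growth argument excludes a homogeneous term only where the Green integral is an exact multiple of
  \<open>u\<close> or \<open>v\<close>. Hence the compact supports. The bound is uniform along
  increasing truncations, so their limit cannot be infinite at every point; and as the Green
  integral consists of two tails whose integrands do not contain \<open>x\<close>, convergence at
  one point spreads to all. Signs do no harm, because the kernel is positive.\<close>

lemma AE_lebesgue_iff_negligible:
  "(AE x in lebesgue. P x) \<longleftrightarrow> negligible {x. \<not> P x}"
  by (simp add: completion.AE_iff_null_sets negligible_iff_null_sets)

text \<open>Outer regularity for null sets: it supplies the open set of small measure into which a
  gauge can force all intervals tagged in \<open>N\<close>.\<close>

lemma negligible_outer_open:
  fixes N :: "'a::euclidean_space set" and e :: real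
  assumes "negligible N" "e > 0"
  obtains U where "open U" "N \<subseteq> U" "U \<in> lmeasurable" "measure lebesgue U < e"
proof -
  have N: "N \<in> null_sets lebesgue"
    using assms(1) by (simp add: negligible_iff_null_sets)
  obtain U where U: "open U" "N \<subseteq> U" "U - N \<in> lmeasurable" "emeasure lebesgue (U - N) < ennreal e"
    using sets_lebesgue_outer_open[OF _ \<open>e > 0\<close>, of N] N by blast
  have em: "emeasure lebesgue (U - N) = emeasure lebesgue U"
    using N U(1) by (intro emeasure_Diff_null_set) auto
  then have "emeasure lebesgue U < ennreal e"
    using U(4) by simp
  then have "U \<in> lmeasurable" "measure lebesgue U < e"
    using U(1) assms(2)
    by (auto simp: fmeasurable_def intro: order_less_trans)
      (simp add: measure_def enn2real_less_iff order_less_trans[OF _ ennreal_less_top])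
  with U that show ?thesis by blast
qed

lemma loc_abs_continuousD:
  assumes "loc_abs_continuous F" "0 < e"
  obtains \<delta> where "\<delta> > 0"
    "\<And>\<D> T. \<lbrakk>\<D> division_of T; T \<subseteq> {a..b}; (\<Sum>K\<in>\<D>. Sup K - Inf K) < \<delta>\<rbrakk>
       \<Longrightarrow> (\<Sum>K\<in>\<D>. \<bar>F (Sup K) - F (Inf K)\<bar>) < e"
  using assms unfolding loc_abs_continuous_def abs_continuous_on_interval_def by metis

lemma sum_length_division:
  fixes \<D> :: "real set set"
  assumes "\<D> division_of T"
  shows "(\<Sum>K\<in>\<D>. Sup K - Inf K) = measure lebesgue T"
proof -
  have "Sup K - Inf K = measure lebesgue K" if "K \<in> \<D>" for K
  proof -
    from that assms obtain a b where "K = {a..b}" "K \<noteq> {}"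
      by (metis cbox_division_memE interval_cbox)
    then show ?thesis by auto
  qed
  then show ?thesis
    using content_division[OF assms] by simp
qed

text \<open>A single closed interval is already a division, so absolute continuity on
  \<open>{x-1..x+1}\<close> gives continuity at \<open>x\<close>; this window is the source of the
  \<open>1\<close> in the radius.\<close>

lemma loc_abs_continuous_imp_isCont:
  assumes "loc_abs_continuous F"
  shows "isCont F x"
  unfolding continuous_at_eps_delta
proof (intro allI impI)
  fix e :: real assume "e > 0"
  obtain d where d: "d > 0" and *: "\<And>\<D> T. \<lbrakk>\<D> division_of T; T \<subseteq> {x-1..x+1}; (\<Sum>K\<in>\<D>. Sup K - Inf K) < d\<rbrakk>
       \<Longrightarrow> (\<Sum>K\<in>\<D>. \<bar>F (Sup K) - F (Inf K)\<bar>) < e"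
    using loc_abs_continuousD[OF assms \<open>e > 0\<close>] by blast
  show "\<exists>d>0. \<forall>x'. dist x' x < d \<longrightarrow> dist (F x') (F x) < e"
  proof (intro exI conjI allI impI)
    show "min d 1 > 0" using d by simp
    fix y assume y: "dist y x < min d 1"
    have "{{min x y..max x y}} division_of {min x y..max x y}"
      using division_of_self[of "min x y" "max x y"] by auto
    from *[OF this] y show "dist (F y) (F x) < e"
      by (cases "x \<le> y") (auto simp: dist_real_def max_def min_def abs_if split: if_splits)
  qed
qed

lemma loc_abs_continuous_imp_continuous_on:
  "loc_abs_continuous F \<Longrightarrow> continuous_on S F"
  by (simp add: continuous_at_imp_continuous_on loc_abs_continuous_imp_isCont)

lemma loc_abs_continuous_bounded:
  assumes "loc_abs_continuous F"
  obtains B where "B > 0" "\<And>x. x \<in> {a..b} \<Longrightarrow> \<bar>F x\<bar> \<le> B"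
proof -
  have "bounded (F ` {a..b})"
    by (intro compact_imp_bounded compact_continuous_image loc_abs_continuous_imp_continuous_on assms) auto
  then show ?thesis
    using that by (auto simp: bounded_pos)
qed

lemma division_of_real_endpoints:
  fixes K :: "real set"
  assumes "\<D> division_of T" "T \<subseteq> {a..b}" "K \<in> \<D>"
  shows "K = {Inf K..Sup K}" "Inf K \<le> Sup K" "Inf K \<in> {a..b}" "Sup K \<in> {a..b}"
proof -
  from assms obtain u v where uv: "K = {u..v}" "K \<noteq> {}" "K \<subseteq> {a..b}"
    by (metis cbox_division_memE interval_cbox order_trans)
  then show "K = {Inf K..Sup K}" "Inf K \<le> Sup K" "Inf K \<in> {a..b}" "Sup K \<in> {a..b}"
    by auto
qed

text \<open>One comparison of increments serves sums, differences and products. The constant may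
  depend on the interval because products require bounds for both factors, which are available on
  compact intervals.\<close>

lemma loc_abs_continuous_combine:
  assumes F: "loc_abs_continuous F" and G: "loc_abs_continuous G"
    and H: "\<And>a b. \<exists>C>0. \<forall>x\<in>{a..b}. \<forall>y\<in>{a..b}.
              \<bar>H x - H y\<bar> \<le> C * (\<bar>F x - F y\<bar> + \<bar>G x - G y\<bar>)"
  shows "loc_abs_continuous H"
  unfolding loc_abs_continuous_def abs_continuous_on_interval_def
proof (intro allI impI)
  fix a b e :: real assume "e > 0"
  obtain C where C: "C > 0" "\<And>x y. x \<in> {a..b} \<Longrightarrow> y \<in> {a..b} \<Longrightarrow>
       \<bar>H x - H y\<bar> \<le> C * (\<bar>F x - F y\<bar> + \<bar>G x - G y\<bar>)"
    using H[of a b] by auto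
  have e: "e / (2 * C) > 0" using \<open>e > 0\<close> C by simp
  obtain d1 where d1: "d1 > 0" "\<And>\<D> T. \<lbrakk>\<D> division_of T; T \<subseteq> {a..b}; (\<Sum>K\<in>\<D>. Sup K - Inf K) < d1\<rbrakk>
       \<Longrightarrow> (\<Sum>K\<in>\<D>. \<bar>F (Sup K) - F (Inf K)\<bar>) < e / (2 * C)"
    using loc_abs_continuousD[OF F e] by blast
  obtain d2 where d2: "d2 > 0" "\<And>\<D> T. \<lbrakk>\<D> division_of T; T \<subseteq> {a..b}; (\<Sum>K\<in>\<D>. Sup K - Inf K) < d2\<rbrakk>
       \<Longrightarrow> (\<Sum>K\<in>\<D>. \<bar>G (Sup K) - G (Inf K)\<bar>) < e / (2 * C)"
    using loc_abs_continuousD[OF G e] by blast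
  show "\<exists>\<delta>>0. \<forall>\<D> T. \<D> division_of T \<longrightarrow> T \<subseteq> {a..b} \<longrightarrow>
        (\<Sum>K\<in>\<D>. Sup K - Inf K) < \<delta> \<longrightarrow> (\<Sum>K\<in>\<D>. \<bar>H (Sup K) - H (Inf K)\<bar>) < e"
  proof (intro exI conjI allI impI)
    show "min d1 d2 > 0" using d1 d2 by simp
    fix \<D> T assume D: "\<D> division_of T" "T \<subseteq> {a..b}" "(\<Sum>K\<in>\<D>. Sup K - Inf K) < min d1 d2"
    have "(\<Sum>K\<in>\<D>. \<bar>H (Sup K) - H (Inf K)\<bar>)
        \<le> (\<Sum>K\<in>\<D>. C * (\<bar>F (Sup K) - F (Inf K)\<bar> + \<bar>G (Sup K) - G (Inf K)\<bar>))"
      by (intro sum_mono C division_of_real_endpoints[OF D(1,2)])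
    also have "\<dots> = C * ((\<Sum>K\<in>\<D>. \<bar>F (Sup K) - F (Inf K)\<bar>) + (\<Sum>K\<in>\<D>. \<bar>G (Sup K) - G (Inf K)\<bar>))"
      by (simp add: sum.distrib flip: sum_distrib_left)
    also have "\<dots> < C * (e / (2 * C) + e / (2 * C))"
      using d1(2)[OF D(1,2)] d2(2)[OF D(1,2)] D(3) C by (intro mult_strict_left_mono add_strict_mono) auto
    also have "\<dots> = e" using C by simp
    finally show "(\<Sum>K\<in>\<D>. \<bar>H (Sup K) - H (Inf K)\<bar>) < e" .
  qed
qed

lemma loc_abs_continuous_diff:
  assumes "loc_abs_continuous F" "loc_abs_continuous G"
  shows "loc_abs_continuous (\<lambda>x. F x - G x)"
  by (rule loc_abs_continuous_combine[OF assms]) (intro exI[of _ 1], auto)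

lemma loc_abs_continuous_add:
  assumes "loc_abs_continuous F" "loc_abs_continuous G"
  shows "loc_abs_continuous (\<lambda>x. F x + G x)"
  by (rule loc_abs_continuous_combine[OF assms]) (intro exI[of _ 1], auto)

lemma loc_abs_continuous_mult:
  assumes F: "loc_abs_continuous F" and G: "loc_abs_continuous G"
  shows "loc_abs_continuous (\<lambda>x. F x * G x)"
proof (rule loc_abs_continuous_combine[OF assms])
  fix a b :: real
  obtain B1 where B1: "B1 > 0" "\<And>x. x \<in> {a..b} \<Longrightarrow> \<bar>F x\<bar> \<le> B1"
    using loc_abs_continuous_bounded[OF F] by blast
  obtain B2 where B2: "B2 > 0" "\<And>x. x \<in> {a..b} \<Longrightarrow> \<bar>G x\<bar> \<le> B2"
    using loc_abs_continuous_bounded[OF G] by blast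
  show "\<exists>C>0. \<forall>x\<in>{a..b}. \<forall>y\<in>{a..b}. \<bar>F x * G x - F y * G y\<bar> \<le> C * (\<bar>F x - F y\<bar> + \<bar>G x - G y\<bar>)"
  proof (intro exI[of _ "B1 + B2"] conjI ballI)
    fix x y assume xy: "x \<in> {a..b}" "y \<in> {a..b}"
    have "F x * G x - F y * G y = (F x - F y) * G x + F y * (G x - G y)"
      by (simp add: algebra_simps)
    then have "\<bar>F x * G x - F y * G y\<bar> \<le> \<bar>F x - F y\<bar> * \<bar>G x\<bar> + \<bar>F y\<bar> * \<bar>G x - G y\<bar>"
      by (metis abs_triangle_ineq abs_mult)
    also have "\<dots> \<le> \<bar>F x - F y\<bar> * (B1 + B2) + (B1 + B2) * \<bar>G x - G y\<bar>"
      using B1(1) B2(1) B1(2)[OF xy(2)] B2(2)[OF xy(1)] by (intro add_mono mult_mono) auto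
    finally show "\<bar>F x * G x - F y * G y\<bar> \<le> (B1 + B2) * (\<bar>F x - F y\<bar> + \<bar>G x - G y\<bar>)"
      by (simp add: algebra_simps)
  qed (use B1 B2 in auto)
qed

section \<open>The fundamental theorem of calculus for locally absolutely continuous
  functions\<close>

lemma content_scaled_minus_increment_le:
  fixes F :: "real \<Rightarrow> real"
  assumes xK: "x \<in> {u..v}" "{u..v} \<subseteq> ball x d"
    and d: "\<And>y. \<bar>y - x\<bar> < d \<Longrightarrow> \<bar>F y - F x - (y - x) * f\<bar> \<le> e * \<bar>y - x\<bar>"
  shows "\<bar>(v - u) * f - (F v - F u)\<bar> \<le> e * (v - u)"
proof -
  have "u \<in> {u..v}" "v \<in> {u..v}" using xK(1) by auto
  then have "\<bar>u - x\<bar> < d" "\<bar>v - x\<bar> < d"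
    using xK(2) by (auto simp: dist_real_def subset_iff)
  with d have "\<bar>F u - F x - (u - x) * f\<bar> \<le> e * \<bar>u - x\<bar>" "\<bar>F v - F x - (v - x) * f\<bar> \<le> e * \<bar>v - x\<bar>"
    by blast+
  \<comment> \<open>The tag lies between the endpoints, so the two one-sided errors add up to
    exactly one interval length.\<close>
  moreover have "e * \<bar>u - x\<bar> + e * \<bar>v - x\<bar> = e * (v - u)"
    using xK(1) by (simp add: algebra_simps)
  moreover have "(v - u) * f - (F v - F u) = (F u - F x - (u - x) * f) - (F v - F x - (v - x) * f)"
    by (simp add: algebra_simps)
  ultimately show ?thesis by linarith
qed

text \<open>On tags in the exceptional null set the Riemann sum vanishes, and the increments of \<open>F\<close>
  are controlled by absolute continuity because the gauge keeps these intervals inside an open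
  set of small measure.\<close>

theorem loc_abs_continuous_has_integral_derivative:
  fixes F f :: "real \<Rightarrow> real"
  assumes ac: "loc_abs_continuous F"
    and ae: "AE x in lebesgue. (F has_real_derivative f x) (at x)"
    and "a \<le> b"
  shows "(f has_integral F b - F a) {a..b}"
proof -
  define N where "N = {x. \<not> (F has_real_derivative f x) (at x)}"
  have N: "negligible N"
    using ae unfolding N_def AE_lebesgue_iff_negligible .
  \<comment> \<open>Nothing is known about \<open>f\<close> on \<open>N\<close>; setting it to
    \<open>0\<close> there does not change the integral.\<close>
  define g where "g x = (if x \<in> N then 0 else f x)" for x
  have "(g has_integral F b - F a) (cbox a b)"
    unfolding has_integral
  proof (intro allI impI)
    fix e :: real assume "e > 0"
    \<comment> \<open>The \<open>1\<close> keeps the denominator positive when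
      \<open>a = b\<close>.\<close>
    define e1 where "e1 = e / (2 * (b - a + 1))"
    have e1: "e1 > 0" "e1 * (b - a) \<le> e / 2"
      using \<open>e > 0\<close> \<open>a \<le> b\<close> by (auto simp: e1_def field_simps)
    have "\<exists>d>0. \<forall>y. \<bar>y - x\<bar> < d \<longrightarrow> \<bar>F y - F x - (y - x) * f x\<bar> \<le> e1 * \<bar>y - x\<bar>" if "x \<notin> N" for x
    proof -
      have "(F has_derivative (*) (f x)) (at x)"
        using that by (simp add: N_def has_field_derivative_def)
      moreover have "(*) (f x) = (\<lambda>h. h * f x)"
        by (simp add: fun_eq_iff)
      ultimately have "(F has_derivative (\<lambda>h. h * f x)) (at x)"
        by simp
      then show ?thesis
        using \<open>e1 > 0\<close> unfolding has_derivative_at_alt real_norm_def by blast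
    qed
    then obtain d where d: "\<And>x. x \<notin> N \<Longrightarrow> d x > 0"
      "\<And>x y. x \<notin> N \<Longrightarrow> \<bar>y - x\<bar> < d x \<Longrightarrow> \<bar>F y - F x - (y - x) * f x\<bar> \<le> e1 * \<bar>y - x\<bar>"
      by metis
    obtain \<delta> where \<delta>: "\<delta> > 0" "\<And>\<D> T. \<lbrakk>\<D> division_of T; T \<subseteq> {a..b}; (\<Sum>K\<in>\<D>. Sup K - Inf K) < \<delta>\<rbrakk>
       \<Longrightarrow> (\<Sum>K\<in>\<D>. \<bar>F (Sup K) - F (Inf K)\<bar>) < e / 2"
      using loc_abs_continuousD[OF ac half_gt_zero[OF \<open>e > 0\<close>]] by blast
    obtain U where U: "open U" "N \<subseteq> U" "U \<in> lmeasurable" "measure lebesgue U < \<delta>"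
      using negligible_outer_open[OF N \<open>\<delta> > 0\<close>] by blast
    define \<gamma> where "\<gamma> x = (if x \<in> N then U else ball x (d x))" for x
    show "\<exists>\<gamma>. gauge \<gamma> \<and> (\<forall>\<D>. \<D> tagged_division_of cbox a b \<and> \<gamma> fine \<D> \<longrightarrow>
            norm ((\<Sum>(x, k)\<in>\<D>. measure lborel k *\<^sub>R g x) - (F b - F a)) < e)"
    proof (intro exI[of _ \<gamma>] conjI allI impI)
      show "gauge \<gamma>"
        using U d(1) by (auto simp: gauge_def \<gamma>_def)
      fix p assume "p tagged_division_of cbox a b \<and> \<gamma> fine p"
      then have p: "p tagged_division_of cbox a b" and fine: "\<gamma> fine p"
        by auto
      have fin: "finite p" using p by blast
      define p1 where "p1 = {(x, K) \<in> p. x \<in> N}"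
      define p2 where "p2 = {(x, K) \<in> p. x \<notin> N}"
      have p12: "p = p1 \<union> p2" "p1 \<inter> p2 = {}" "p1 \<subseteq> p" "p2 \<subseteq> p" "finite p1" "finite p2"
        using fin by (auto simp: p1_def p2_def intro: finite_subset)
      let ?D = "\<lambda>K. F (Sup K) - F (Inf K)"
      have Kuv: "\<exists>u v. K = {u..v} \<and> u \<le> v \<and> x \<in> K \<and> K \<subseteq> \<gamma> x" if "(x, K) \<in> p" for x K
        using that fine tagged_division_ofD(2,4)[OF p that] by (fastforce simp: fine_def)
      have inc: "F b - F a = (\<Sum>(x, K)\<in>p. ?D K)"
        using additive_tagged_division_1[OF \<open>a \<le> b\<close>, of p F] p by simp
      have eq: "(\<Sum>(x, K)\<in>p. measure lborel K *\<^sub>R g x) - (F b - F a)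
          = (\<Sum>(x, K)\<in>p2. measure lborel K * g x - ?D K) + (\<Sum>(x, K)\<in>p1. measure lborel K * g x - ?D K)"
        unfolding inc sum_subtractf[symmetric] using p12
        by (simp add: split_def sum.union_disjoint sum_subtractf)
      have 2: "\<bar>\<Sum>(x, K)\<in>p2. measure lborel K * g x - ?D K\<bar> \<le> e / 2"
      proof -
        have "\<bar>\<Sum>(x, K)\<in>p2. measure lborel K * g x - ?D K\<bar> \<le> (\<Sum>(x, K)\<in>p2. e1 * measure lborel K)"
          unfolding split_def
        proof (rule order_trans[OF sum_abs sum_mono], clarsimp)
          fix x K assume "(x, K) \<in> p2"
          then have xK: "(x, K) \<in> p" "x \<notin> N" by (auto simp: p2_def)
          then obtain u v where K: "K = {u..v}" "u \<le> v" "x \<in> K" "K \<subseteq> \<gamma> x"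
            using Kuv by blast
          have "\<bar>(v - u) * f x - (F v - F u)\<bar> \<le> e1 * (v - u)"
            using K xK(2) d(2)[OF xK(2)]
            by (intro content_scaled_minus_increment_le[where d = "d x" and x = x]) (auto simp: \<gamma>_def)
          then show "\<bar>measure lborel K * g x - (F (Sup K) - F (Inf K))\<bar> \<le> e1 * measure lborel K"
            using K xK by (simp add: g_def)
        qed
        also have "\<dots> \<le> (\<Sum>(x, K)\<in>p. e1 * measure lborel K)"
          using p12 fin e1 by (intro sum_mono2) (auto simp: split_def)
        also have "\<dots> = e1 * (\<Sum>(x, K)\<in>p. measure lborel K)"
          by (simp add: sum_distrib_left split_def)
        also have "\<dots> = e1 * (b - a)"
          using additive_content_tagged_division[OF p] \<open>a \<le> b\<close> by simp
        finally show ?thesis using e1 by simp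
      qed
      have 1: "\<bar>\<Sum>(x, K)\<in>p1. measure lborel K * g x - ?D K\<bar> < e / 2"
      proof -
        have p1: "p1 tagged_partial_division_of cbox a b"
          using p p12(3) tagged_partial_division_subset tagged_division_of_def by blast
        let ?T = "\<Union>(snd ` p1)"
        have div: "snd ` p1 division_of ?T"
          by (rule partial_division_of_tagged_division[OF p1])
        have Tsub: "?T \<subseteq> {a..b}" "?T \<subseteq> U"
          using tagged_partial_division_ofD(3)[OF p1] Kuv by (fastforce simp: p1_def \<gamma>_def)+
        have "measure lebesgue ?T \<le> measure lebesgue U"
          using Tsub U lmeasurable_division[OF div] by (intro measure_mono_fmeasurable) (auto simp: fmeasurableD)
        then have len: "(\<Sum>K\<in>snd ` p1. Sup K - Inf K) < \<delta>"
          using sum_length_division[OF div] U(4) by simp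
        \<comment> \<open>An interval may occur with several tags only if it is degenerate, and then
          it has to contribute \<open>0\<close>. The empty interval is set to \<open>0\<close> by
          hand, because \<open>Sup\<close> and \<open>Inf\<close> of the empty set carry no
          information.\<close>
        let ?d = "\<lambda>K. if K = {} then 0 else \<bar>?D K\<bar>"
        have "\<bar>\<Sum>(x, K)\<in>p1. measure lborel K * g x - ?D K\<bar> \<le> (\<Sum>(x, K)\<in>p1. ?d K)"
          unfolding split_def
        proof (rule order_trans[OF sum_abs sum_mono], clarify)
          fix x K assume *: "(x, K) \<in> p1"
          then have "K \<noteq> {}" "x \<in> N" using Kuv by (auto simp: p1_def)
          then show "\<bar>measure lborel (snd (x, K)) * g (fst (x, K)) - ?D (snd (x, K))\<bar> \<le> ?d (snd (x, K))"
            by (simp add: g_def)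
        qed
        also have "\<dots> = (\<Sum>K\<in>snd ` p1. ?d K)"
        proof (rule sum.over_tagged_division_lemma[OF tagged_partial_division_of_Union_self[OF p1]])
          fix u v :: real assume "box u v = {}"
          then show "?d (cbox u v) = 0" by (cases "u = v") (auto simp: box_eq_empty)
        qed
        also have "\<dots> \<le> (\<Sum>K\<in>snd ` p1. \<bar>?D K\<bar>)"
          by (intro sum_mono) auto
        also have "\<dots> < e / 2"
          using \<delta>(2)[OF div Tsub(1) len] .
        finally show ?thesis .
      qed
      show "norm ((\<Sum>(x, k)\<in>p. measure lborel k *\<^sub>R g x) - (F b - F a)) < e"
        unfolding eq real_norm_def using 1 2 by linarith
    qed
  qed
  then have "(g has_integral F b - F a) {a..b}" by simp
  then show ?thesis
    by (rule has_integral_spike[OF N, rotated]) (simp add: g_def)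
qed

section \<open>Differentiation of indefinite integrals\<close>

text \<open>Every point of the exceptional set is the tag of arbitrarily short intervals on which
  the Riemann term misses the integral by more than \<eta> times the length. Vitali's theorem
  selects disjoint ones that cover almost the whole set. By Henstock's lemma the errors of a fine
  partial division sum to less than \<eta> times \<epsilon>, so the total length is less than
  \<epsilon>.\<close>

lemma negligible_large_difference_quotient:
  fixes f F :: "real \<Rightarrow> real"
  assumes int: "f integrable_on {a..b}"
    and F: "\<And>x y. a \<le> x \<Longrightarrow> x \<le> y \<Longrightarrow> y \<le> b \<Longrightarrow> F y - F x = integral {x..y} f"
    and "\<eta> > 0"
  shows "negligible {x \<in> {a..b}. \<forall>d>0. \<exists>y\<in>{a..b}. \<bar>y - x\<bar> < d \<and>
            \<bar>F y - F x - (y - x) * f x\<bar> > \<eta> * \<bar>y - x\<bar>}"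
    (is "negligible ?E")
  unfolding negligible_outer_le
proof (intro allI impI)
  fix \<epsilon> :: real assume "\<epsilon> > 0"
  obtain \<gamma> where \<gamma>: "gauge \<gamma>" "\<And>p. \<lbrakk>p tagged_partial_division_of cbox a b; \<gamma> fine p\<rbrakk> \<Longrightarrow>
             (\<Sum>(x,K)\<in>p. norm (measure lborel K *\<^sub>R f x - integral K f)) < \<eta> * \<epsilon>"
    using Henstock_lemma[of f a b "\<eta> * \<epsilon>"] int \<open>\<epsilon> > 0\<close> \<open>\<eta> > 0\<close> by auto
  \<comment> \<open>In a pair, \<open>fst i\<close> is the tag and \<open>snd i\<close> the other
    endpoint, on either side of it. Vitali's theorem takes balls and Henstock's lemma takes
    intervals containing their tag; the ball about the midpoint is that interval.\<close>
  define c where "c i = (fst i + snd i) / 2" for i :: "real \<times> real"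
  define r where "r i = \<bar>snd i - fst i\<bar> / 2" for i :: "real \<times> real"
  define I where "I i = {min (fst i) (snd i)..max (fst i) (snd i)}" for i :: "real \<times> real"
  have cball_I: "cball (c i) (r i) = I i" for i
    by (auto simp: cball_eq_atLeastAtMost c_def r_def I_def field_simps min_def max_def)
  define Q where "Q = {i. fst i \<in> {a..b} \<and> snd i \<in> {a..b} \<and> I i \<subseteq> \<gamma> (fst i) \<and>
      \<bar>F (snd i) - F (fst i) - (snd i - fst i) * f (fst i)\<bar> > \<eta> * \<bar>snd i - fst i\<bar>}"
  obtain C where C: "countable C" "C \<subseteq> Q"
     "pairwise (\<lambda>i j. disjnt (I i) (I j)) C"
     "negligible (?E - (\<Union>i \<in> C. I i))"
  proof (rule Vitali_covering_theorem_cballs[of Q r ?E c, unfolded cball_I])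
    show "0 < r i" if "i \<in> Q" for i
      using that by (auto simp: Q_def r_def)
    show "\<exists>i. i \<in> Q \<and> x \<in> I i \<and> r i < d" if x: "x \<in> ?E" and d: "0 < d" for x d
    proof -
      obtain s where s: "s > 0" "ball x s \<subseteq> \<gamma> x"
        using \<gamma>(1) by (meson gauge_def open_contains_ball)
      have "min s d > 0" using s d by simp
      then have "\<exists>y\<in>{a..b}. \<bar>y - x\<bar> < min s d \<and> \<bar>F y - F x - (y - x) * f x\<bar> > \<eta> * \<bar>y - x\<bar>"
        using x by blast
      then obtain y where y: "y \<in> {a..b}" "\<bar>y - x\<bar> < min s d"
          "\<bar>F y - F x - (y - x) * f x\<bar> > \<eta> * \<bar>y - x\<bar>"
        by blast
      have "I (x, y) \<subseteq> ball x s"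
        using y(2) by (auto simp: I_def dist_real_def)
      then have "(x, y) \<in> Q"
        using x y s by (auto simp: Q_def)
      moreover have "x \<in> I (x, y)" "r (x, y) < d"
        using y(2) by (auto simp: I_def r_def)
      ultimately show ?thesis by blast
    qed
  qed (use that in auto)
  \<comment> \<open>Partial divisions are finite. A bound uniform over finite subfamilies passes to
    the countable union.\<close>
  have bound: "measure lebesgue (\<Union>i\<in>J. I i) \<le> \<epsilon>" if J: "J \<subseteq> C" "finite J" for J
  proof -
    define p where "p = (\<lambda>i. (fst i, I i)) ` J"
    have JQ: "i \<in> Q" if "i \<in> J" for i using that J C by blast
    have disj: "I i \<inter> I j = {}" if "i \<in> J" "j \<in> J" "i \<noteq> j" for i j
      using that C(3) J by (auto simp: pairwise_def disjnt_def)
    have mem: "fst i \<in> I i" for i by (simp add: I_def)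
    have inj: "inj_on (\<lambda>i. (fst i, I i)) J"
    proof (rule inj_onI)
      show "i = j" if "i \<in> J" "j \<in> J" "(fst i, I i) = (fst j, I j)" for i j
        using disj[OF that(1,2)] mem[of i] that(3) by auto
    qed
    have "p tagged_partial_division_of cbox a b"
      unfolding tagged_partial_division_of_def
    proof (intro conjI allI impI)
      show "finite p" using J by (simp add: p_def)
      fix x K assume "(x, K) \<in> p"
      then obtain i where i: "i \<in> J" "x = fst i" "K = I i" by (auto simp: p_def)
      show "x \<in> K" "K \<subseteq> cbox a b" "\<exists>u v. K = cbox u v"
        using mem JQ[OF i(1)] i by (auto simp: Q_def I_def)
    next
      fix x1 K1 x2 K2 assume "(x1, K1) \<in> p \<and> (x2, K2) \<in> p \<and> (x1, K1) \<noteq> (x2, K2)"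
      then obtain i j where "i \<in> J" "j \<in> J" "i \<noteq> j" "K1 = I i" "K2 = I j" by (auto simp: p_def)
      then show "interior K1 \<inter> interior K2 = {}"
        using disj interior_subset by blast
    qed
    moreover have "\<gamma> fine p"
      using JQ by (auto simp: fine_def p_def Q_def)
    ultimately have less: "(\<Sum>(x,K)\<in>p. norm (measure lborel K *\<^sub>R f x - integral K f)) < \<eta> * \<epsilon>"
      by (rule \<gamma>(2))
    have "\<eta> * (\<Sum>i\<in>J. measure lebesgue (I i)) \<le> (\<Sum>i\<in>J. \<bar>measure lborel (I i) * f (fst i) - integral (I i) f\<bar>)"
      unfolding sum_distrib_left
    proof (rule sum_mono)
      fix i assume "i \<in> J"
      then have i: "fst i \<in> {a..b}" "snd i \<in> {a..b}"
          "\<bar>F (snd i) - F (fst i) - (snd i - fst i) * f (fst i)\<bar> > \<eta> * \<bar>snd i - fst i\<bar>"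
        using JQ by (auto simp: Q_def)
      show "\<eta> * measure lebesgue (I i) \<le> \<bar>measure lborel (I i) * f (fst i) - integral (I i) f\<bar>"
      proof (cases "fst i \<le> snd i")
        case True
        then show ?thesis
          using i F[of "fst i" "snd i"] by (simp add: I_def min_def max_def algebra_simps)
      next
        case False
        then have "integral (I i) f = F (fst i) - F (snd i)"
          using i F[of "snd i" "fst i"] by (simp add: I_def min_def max_def)
        with False i(3) show ?thesis
          by (simp add: I_def min_def max_def algebra_simps)
      qed
    qed
    also have "\<dots> = (\<Sum>(x,K)\<in>p. norm (measure lborel K *\<^sub>R f x - integral K f))"
      unfolding p_def by (subst sum.reindex[OF inj]) simp
    finally have "\<eta> * (\<Sum>i\<in>J. measure lebesgue (I i)) < \<eta> * \<epsilon>"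
      using less by simp
    then have "(\<Sum>i\<in>J. measure lebesgue (I i)) < \<epsilon>"
      using \<open>\<eta> > 0\<close> by simp
    moreover have "measure lebesgue (\<Union>i\<in>J. I i) \<le> (\<Sum>i\<in>J. measure lebesgue (I i))"
      by (rule measure_UNION_le[OF J(2)]) (simp add: I_def)
    ultimately show ?thesis by simp
  qed
  have lm: "I i \<in> lmeasurable" for i by (simp add: I_def)
  have U: "(\<Union>i\<in>C. I i) \<in> lmeasurable" "measure lebesgue (\<Union>i\<in>C. I i) \<le> \<epsilon>"
    by (rule fmeasurable_UN_bound[OF C(1) lm bound] measure_UN_bound[OF C(1) lm bound]; assumption)+
  have N: "?E - (\<Union>i \<in> C. I i) \<in> lmeasurable" "measure lebesgue (?E - (\<Union>i \<in> C. I i)) = 0"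
    using C(4) by (auto simp: negligible_imp_measurable negligible_imp_measure0)
  show "\<exists>T. ?E \<subseteq> T \<and> T \<in> lmeasurable \<and> measure lebesgue T \<le> \<epsilon>"
  proof (intro exI conjI)
    let ?T = "(?E - (\<Union>i \<in> C. I i)) \<union> (\<Union>i\<in>C. I i)"
    show "?E \<subseteq> ?T" by blast
    show "?T \<in> lmeasurable" using N(1) U(1) by (rule fmeasurable.Un)
    have "measure lebesgue ?T \<le> measure lebesgue (?E - (\<Union>i \<in> C. I i)) + measure lebesgue (\<Union>i\<in>C. I i)"
      using N(1) U(1) by (intro measure_Un_le) (auto simp: fmeasurableD)
    then show "measure lebesgue ?T \<le> \<epsilon>"
      using N(2) U(2) by linarith
  qed
qed

text \<open>Where the derivative fails to be \<open>f x\<close>, some tolerance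
  \<open>inverse (real (Suc k))\<close> is violated arbitrarily close to \<open>x\<close> inside
  some window \<open>{- real m..real m}\<close>. The exceptional set is therefore a countable union
  of null sets.\<close>

theorem indefinite_integral_has_derivative_AE:
  fixes f F :: "real \<Rightarrow> real"
  assumes F: "\<And>x y. x \<le> y \<Longrightarrow> (f has_integral F y - F x) {x..y}"
  shows "AE x in lebesgue. (F has_real_derivative f x) (at x)"
proof -
  define E where "E m k = {x \<in> {- real m..real m}. \<forall>d>0. \<exists>y\<in>{- real m..real m}. \<bar>y - x\<bar> < d \<and>
            \<bar>F y - F x - (y - x) * f x\<bar> > inverse (real (Suc k)) * \<bar>y - x\<bar>}" for m k
  have "negligible (E m k)" for m k
    unfolding E_def
  proof (rule negligible_large_difference_quotient)
    show "f integrable_on {- real m..real m}"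
      by (rule has_integral_integrable[OF F]) simp
    show "F y - F x = integral {x..y} f" if "x \<le> y" for x y
      using integral_unique[OF F[OF that]] by simp
  qed simp
  then have N: "negligible (\<Union>m. \<Union>k. E m k)"
    by (intro negligible_countable_Union) auto
  have "(F has_real_derivative f x) (at x)" if x: "x \<notin> (\<Union>m. \<Union>k. E m k)" for x
  proof -
    obtain m where m: "\<bar>x\<bar> < real m" using reals_Archimedean2 by blast
    have "(F has_derivative (*) (f x)) (at x)"
      unfolding has_derivative_at_alt
    proof (intro conjI allI impI)
      show "bounded_linear ((*) (f x))" by (rule bounded_linear_mult_right)
      fix e :: real assume "e > 0"
      then obtain k where k: "inverse (real (Suc k)) < e" using reals_Archimedean by blast
      have "x \<notin> E m k" using x by blast
      then obtain d where d: "d > 0" "\<And>y. \<lbrakk>y \<in> {- real m..real m}; \<bar>y - x\<bar> < d\<rbrakk> \<Longrightarrow>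
            \<bar>F y - F x - (y - x) * f x\<bar> \<le> inverse (real (Suc k)) * \<bar>y - x\<bar>"
        using m unfolding E_def by (auto simp: not_less) (metis atLeastAtMost_iff not_less)
      show "\<exists>d>0. \<forall>y. norm (y - x) < d \<longrightarrow> norm (F y - F x - f x * (y - x)) \<le> e * norm (y - x)"
      proof (intro exI conjI allI impI)
        \<comment> \<open>The second entry keeps \<open>y\<close> inside the window to which the
          estimate for \<open>d\<close> applies.\<close>
        show "min d (real m - \<bar>x\<bar>) > 0" using d m by simp
        fix y assume y: "norm (y - x) < min d (real m - \<bar>x\<bar>)"
        then have "\<bar>F y - F x - (y - x) * f x\<bar> \<le> inverse (real (Suc k)) * \<bar>y - x\<bar>"
          by (intro d(2)) auto
        also have "\<dots> \<le> e * \<bar>y - x\<bar>" using k by (intro mult_right_mono) auto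
        finally show "norm (F y - F x - f x * (y - x)) \<le> e * norm (y - x)"
          by (simp add: mult.commute)
      qed
    qed
    then show ?thesis by (simp add: has_field_derivative_def)
  qed
  then show ?thesis
    unfolding AE_lebesgue_iff_negligible by (intro negligible_subset[OF N]) blast
qed

section \<open>Absolute continuity of indefinite integrals\<close>

lemma absolutely_integrable_truncation:
  fixes f :: "real \<Rightarrow> real"
  assumes f: "f absolutely_integrable_on S" and "e > 0"
  obtains n :: nat where "(\<lambda>x. \<bar>f x\<bar> - min (\<bar>f x\<bar>) (real n)) absolutely_integrable_on S"
    "integral S (\<lambda>x. \<bar>f x\<bar> - min (\<bar>f x\<bar>) (real n)) < e"
proof -
  define h where "h n x = indicator S x *\<^sub>R (\<bar>f x\<bar> - min (\<bar>f x\<bar>) (real n))" for n x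
  have [measurable]: "(\<lambda>x. indicator S x *\<^sub>R \<bar>f x\<bar>) \<in> borel_measurable lebesgue"
    using absolutely_integrable_norm[OF f] unfolding set_integrable_def
    by (auto dest: borel_measurable_integrable)
  have int: "integrable lebesgue (\<lambda>x. indicator S x *\<^sub>R \<bar>f x\<bar>)"
    using absolutely_integrable_norm[OF f] unfolding set_integrable_def by simp
  have h_eq: "h n x = indicator S x *\<^sub>R \<bar>f x\<bar> - min (indicator S x *\<^sub>R \<bar>f x\<bar>) (real n)" for n x
    by (auto simp: h_def indicator_def)
  have h_meas: "h n \<in> borel_measurable lebesgue" for n
    unfolding h_eq[abs_def] by measurable
  have lim: "(\<lambda>n. h n x) \<longlonglongrightarrow> 0" for x
  proof (rule tendsto_eventually, rule eventually_sequentiallyI)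
    fix n assume "nat \<lceil>\<bar>f x\<bar>\<rceil> \<le> n"
    then have "\<bar>f x\<bar> \<le> real n" by linarith
    then show "h n x = 0" by (simp add: h_def min_def)
  qed
  have bnd: "norm (h n x) \<le> indicator S x *\<^sub>R \<bar>f x\<bar>" for n x
    by (auto simp: h_def indicator_def)
  have "(\<lambda>n. integral\<^sup>L lebesgue (h n)) \<longlonglongrightarrow> integral\<^sup>L lebesgue (\<lambda>x::real. 0)"
    by (rule integral_dominated_convergence[where w = "\<lambda>x. indicator S x *\<^sub>R \<bar>f x\<bar>"])
       (use lim bnd int h_meas in auto)
  then have "(\<lambda>n. integral\<^sup>L lebesgue (h n)) \<longlonglongrightarrow> 0" by simp
  from order_tendstoD(2)[OF this \<open>e > 0\<close>] obtain n where n: "integral\<^sup>L lebesgue (h n) < e"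
    by (auto simp: eventually_sequentially)
  have "integrable lebesgue (h n)"
    by (rule Bochner_Integration.integrable_bound[OF int h_meas]) (use bnd in auto)
  then have ai: "(\<lambda>x. \<bar>f x\<bar> - min (\<bar>f x\<bar>) (real n)) absolutely_integrable_on S"
    by (simp add: set_integrable_def h_def[abs_def])
  have "integral S (\<lambda>x. \<bar>f x\<bar> - min (\<bar>f x\<bar>) (real n)) < e"
    using n unfolding set_lebesgue_integral_eq_integral(2)[OF ai, symmetric]
    by (simp add: set_lebesgue_integral_def h_def[abs_def])
  with ai that show ?thesis by blast
qed

text \<open>The absolute value of \<open>f\<close> splits into a part bounded by \<open>n\<close>
  and a remainder \<open>g\<close> of small integral. On a family of intervals the first contributes
  at most \<open>n\<close> times the total length, the second at most its whole integral.\<close>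

lemma indefinite_integral_loc_abs_continuous:
  fixes f F :: "real \<Rightarrow> real"
  assumes ai: "\<And>a b. f absolutely_integrable_on {a..b}"
    and F: "\<And>x y. x \<le> y \<Longrightarrow> (f has_integral F y - F x) {x..y}"
  shows "loc_abs_continuous F"
  unfolding loc_abs_continuous_def abs_continuous_on_interval_def
proof (intro allI impI)
  fix a b e :: real assume "e > 0"
  obtain n :: nat where n: "(\<lambda>x. \<bar>f x\<bar> - min (\<bar>f x\<bar>) (real n)) absolutely_integrable_on {a..b}"
    "integral {a..b} (\<lambda>x. \<bar>f x\<bar> - min (\<bar>f x\<bar>) (real n)) < e / 2"
    using absolutely_integrable_truncation[OF ai half_gt_zero[OF \<open>e > 0\<close>]] by blast
  define g where "g x = \<bar>f x\<bar> - min (\<bar>f x\<bar>) (real n)" for x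
  have g0: "g x \<ge> 0" for x by (simp add: g_def)
  show "\<exists>\<delta>>0. \<forall>\<D> T. \<D> division_of T \<longrightarrow> T \<subseteq> {a..b} \<longrightarrow>
        (\<Sum>K\<in>\<D>. Sup K - Inf K) < \<delta> \<longrightarrow> (\<Sum>K\<in>\<D>. \<bar>F (Sup K) - F (Inf K)\<bar>) < e"
  proof (intro exI conjI allI impI)
    \<comment> \<open>At this total length the bounded part contributes at most
      \<open>e / 2\<close>; the added \<open>1\<close> covers \<open>n = 0\<close>.\<close>
    show "e / (2 * (real n + 1)) > 0" using \<open>e > 0\<close> by simp
    fix \<D> T assume D: "\<D> division_of T" "T \<subseteq> {a..b}" "(\<Sum>K\<in>\<D>. Sup K - Inf K) < e / (2 * (real n + 1))"
    have gT: "g absolutely_integrable_on T"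
      using n(1) D(2) lmeasurable_division[OF D(1)] unfolding g_def
      by (auto intro: set_integrable_subset fmeasurableD)
    have gab: "g integrable_on {a..b}"
      using n(1) unfolding g_def by (rule set_lebesgue_integral_eq_integral)
    have "\<bar>F (Sup K) - F (Inf K)\<bar> \<le> integral K g + real n * (Sup K - Inf K)" if "K \<in> \<D>" for K
    proof -
      note K = division_of_real_endpoints[OF D(1,2) that]
      have fK: "(f has_integral F (Sup K) - F (Inf K)) K"
        using F[OF K(2)] K(1) by simp
      have gK: "g integrable_on K"
        using gab K by (metis atLeastAtMost_iff atLeastatMost_subset_iff integrable_on_subinterval)
      have "((\<lambda>x. g x + real n) has_integral integral K g + measure lborel {Inf K..Sup K} *\<^sub>R real n) K"
        using gK K(1) has_integral_const_real[of "real n" "Inf K" "Sup K"]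
        by (intro has_integral_add integrable_integral) auto
      then have gn: "((\<lambda>x. g x + real n) has_integral integral K g + real n * (Sup K - Inf K)) K"
        using K(2) by (simp add: mult.commute)
      have "F (Sup K) - F (Inf K) \<le> integral K g + real n * (Sup K - Inf K)"
        by (rule has_integral_le[OF fK gn]) (auto simp: g_def)
      moreover have "- (F (Sup K) - F (Inf K)) \<le> integral K g + real n * (Sup K - Inf K)"
        by (rule has_integral_le[OF has_integral_neg[OF fK] gn]) (auto simp: g_def)
      ultimately show ?thesis by linarith
    qed
    then have "(\<Sum>K\<in>\<D>. \<bar>F (Sup K) - F (Inf K)\<bar>) \<le> (\<Sum>K\<in>\<D>. integral K g + real n * (Sup K - Inf K))"
      by (rule sum_mono)
    also have "\<dots> = (\<Sum>K\<in>\<D>. integral K g) + real n * (\<Sum>K\<in>\<D>. Sup K - Inf K)"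
      by (simp add: sum.distrib sum_distrib_left)
    also have "(\<Sum>K\<in>\<D>. integral K g) = integral T g"
      using integral_combine_division_topdown[OF set_lebesgue_integral_eq_integral(1)[OF gT] D(1)] by simp
    also have "integral T g \<le> integral {a..b} g"
      using D(2) set_lebesgue_integral_eq_integral(1)[OF gT] gab g0 by (intro integral_subset_le) auto
    also have "integral {a..b} g < e / 2" using n(2) unfolding g_def .
    also have "real n * (\<Sum>K\<in>\<D>. Sup K - Inf K) \<le> real n * (e / (2 * (real n + 1)))"
      using D(3) by (intro mult_left_mono) auto
    also have "\<dots> \<le> e / 2" using \<open>e > 0\<close> by (simp add: field_simps)
    finally show "(\<Sum>K\<in>\<D>. \<bar>F (Sup K) - F (Inf K)\<bar>) < e" by simp
  qed
qed

lemma continuous_derivative_imp_loc_abs_continuous: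
  fixes F f :: "real \<Rightarrow> real"
  assumes "\<And>x. (F has_real_derivative f x) (at x)" "continuous_on UNIV f"
  shows "loc_abs_continuous F"
proof (rule indefinite_integral_loc_abs_continuous)
  show "f absolutely_integrable_on {a..b}" for a b
    using assms(2) by (intro absolutely_integrable_continuous_real) (auto intro: continuous_on_subset)
  show "(f has_integral F y - F x) {x..y}" if "x \<le> y" for x y
    using assms(1) that
    by (intro fundamental_theorem_of_calculus)
       (auto simp flip: has_real_derivative_iff_has_vector_derivative intro: has_field_derivative_at_within)
qed

section \<open>Weighted spaces and growth\<close>

lemma continuous_on_imp_borel_measurable_lebesgue:
  "continuous_on UNIV w \<Longrightarrow> w \<in> borel_measurable lebesgue"
  for w :: "real \<Rightarrow> real"
  by (intro measurable_completion) (simp add: borel_measurable_continuous_onI)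

lemma absolutely_integrable_continuous_mult:
  fixes g h :: "real \<Rightarrow> real"
  assumes g: "continuous_on {a..b} g" and h: "h absolutely_integrable_on {a..b}"
  shows "(\<lambda>x. g x * h x) absolutely_integrable_on {a..b}"
  using g h
  by (intro absolutely_integrable_bounded_measurable_product_real continuous_imp_measurable_on_sets_lebesgue)
     (auto intro: compact_imp_bounded compact_continuous_image)

text \<open>The bound \<open>\<bar>f x\<bar> \<le> 1 + \<bar>f x\<bar> powr p\<close> suffices on
  bounded intervals. It makes data of the weighted spaces accessible to variation of
  constants.\<close>

lemma Lp_loc_imp_absolutely_integrable:
  assumes "f \<in> Lp_loc p" "1 \<le> p"
  shows "f absolutely_integrable_on {a..b}"
proof (rule measurable_bounded_by_integrable_imp_absolutely_integrable)
  show "f \<in> borel_measurable (lebesgue_on {a..b})"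
    using assms(1) by (auto simp: Lp_loc_def intro: measurable_restrict_space1)
  have "(\<lambda>x. \<bar>f x\<bar> powr p) integrable_on {a..b}"
    using assms(1) by (auto simp: Lp_loc_def intro: set_lebesgue_integral_eq_integral)
  then show "(\<lambda>x. 1 + \<bar>f x\<bar> powr p) integrable_on {a..b}"
    by (intro integrable_add integrable_const_ivl)
  show "norm (f x) \<le> 1 + \<bar>f x\<bar> powr p" for x
  proof (cases "\<bar>f x\<bar> \<le> 1")
    case True
    then show ?thesis by (simp add: add_increasing2)
  next
    case False
    then have "\<bar>f x\<bar> powr 1 \<le> \<bar>f x\<bar> powr p"
      using assms(2) by (intro powr_mono) auto
    with False show ?thesis by simp
  qed
qed simp

text \<open>A positive continuous weight has a positive minimum on each compact interval, so
  weighted integrability already forces local integrability. Membership then amounts to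
  measurability and one integral.\<close>

lemma mem_Lp_weighted_iff:
  assumes w: "continuous_on UNIV w" "\<And>x. w x > 0" and "0 \<le> p"
  shows "f \<in> Lp_weighted p w \<longleftrightarrow>
    f \<in> borel_measurable lebesgue \<and> integrable lebesgue (\<lambda>x. \<bar>w x * f x\<bar> powr p)"
proof -
  have "(\<lambda>x. \<bar>f x\<bar> powr p) absolutely_integrable_on {a..b}"
    if f: "f \<in> borel_measurable lebesgue" and int: "integrable lebesgue (\<lambda>x. \<bar>w x * f x\<bar> powr p)" for a b
  proof (cases "a \<le> b")
    case True
    obtain z where z: "z \<in> {a..b}" "\<And>x. x \<in> {a..b} \<Longrightarrow> w z \<le> w x"
      using continuous_attains_inf[of "{a..b}" w] True continuous_on_subset[OF w(1)] by auto
    have "integrable lebesgue (\<lambda>x. indicator {a..b} x *\<^sub>R \<bar>f x\<bar> powr p)"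
    proof (rule Bochner_Integration.integrable_bound)
      show "integrable lebesgue (\<lambda>x. (1 / w z) powr p * \<bar>w x * f x\<bar> powr p)"
        using int by simp
      show "(\<lambda>x. indicator {a..b} x *\<^sub>R \<bar>f x\<bar> powr p) \<in> borel_measurable lebesgue"
        using f by (intro borel_measurable_scaleR borel_measurable_indicator powr_real_measurable borel_measurable_abs) auto
      have "\<bar>f x\<bar> powr p \<le> (1 / w z) powr p * \<bar>w x * f x\<bar> powr p" if "x \<in> {a..b}" for x
      proof -
        have "\<bar>f x\<bar> \<le> \<bar>w x * f x\<bar> / w z"
          using z(2)[OF that] w(2)[of z] w(2)[of x] by (simp add: abs_mult field_simps mult_right_mono)
        then have "\<bar>f x\<bar> powr p \<le> (\<bar>w x * f x\<bar> / w z) powr p"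
          using \<open>0 \<le> p\<close> by (intro powr_mono2) auto
        then show ?thesis
          using w(2)[of z] by (simp add: powr_divide)
      qed
      then show "AE x in lebesgue. norm (indicator {a..b} x *\<^sub>R \<bar>f x\<bar> powr p)
          \<le> norm ((1 / w z) powr p * \<bar>w x * f x\<bar> powr p)"
        by (auto simp: indicator_def)
    qed
    then show ?thesis unfolding set_integrable_def .
  qed auto
  then show ?thesis
    by (auto simp: Lp_weighted_def Lp_loc_def)
qed

section \<open>Linear growth makes the weight integrable\<close>

lemma nn_integral_abs_powr_finite:
  fixes r :: real
  assumes "r > 1"
  shows "(\<integral>\<^sup>+x. ennreal (\<bar>x\<bar> powr - r) * indicator {x. 1 \<le> \<bar>x\<bar>} x \<partial>lebesgue) < \<infinity>"
proof -
  have lim: "((\<lambda>x. x powr (1 - r) / (1 - r)) \<longlongrightarrow> 0 / (1 - r)) at_top"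
    using assms by (intro tendsto_divide tendsto_neg_powr filterlim_ident tendsto_const) auto
  have "(\<integral>\<^sup>+x. ennreal (x powr - r) * indicator {1..} x \<partial>lborel) = 0 / (1 - r) - 1 powr (1 - r) / (1 - r)"
  proof (rule nn_integral_FTC_atLeast[OF _ _ _ lim])
    fix x :: real assume "1 \<le> x"
    then have "((\<lambda>x. x powr (1 - r) / (1 - r)) has_real_derivative (1 - r) * x powr (1 - r - 1) / (1 - r)) (at x)"
      by (intro DERIV_cdivide has_real_derivative_powr) simp
    then show "((\<lambda>x. x powr (1 - r) / (1 - r)) has_real_derivative x powr - r) (at x)"
      using assms by simp
  qed auto
  then have R: "(\<integral>\<^sup>+x. ennreal (\<bar>x\<bar> powr - r) * indicator {1..} x \<partial>lborel) < \<infinity>"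
    by (subst nn_integral_cong[where v = "\<lambda>x. ennreal (x powr - r) * indicator {1..} x"])
       (auto simp: indicator_def)
  have L: "(\<integral>\<^sup>+x. ennreal (\<bar>x\<bar> powr - r) * indicator {..-1} x \<partial>lborel) < \<infinity>"
  proof (subst nn_integral_real_affine[where c = "-1" and t = 0])
    have "(\<lambda>x::real. indicator {..-1} (0 + -1 * x) :: ennreal) = indicator {1..}"
      by (auto simp: indicator_def fun_eq_iff)
    then show "ennreal \<bar>-1\<bar> * (\<integral>\<^sup>+x. ennreal (\<bar>0 + -1 * x\<bar> powr - r) * indicator {..-1} (0 + -1 * x) \<partial>lborel) < \<infinity>"
      using R by (simp add: fun_eq_iff)
  qed auto
  have "(\<integral>\<^sup>+x. ennreal (\<bar>x\<bar> powr - r) * indicator {x. 1 \<le> \<bar>x\<bar>} x \<partial>lborel)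
     = (\<integral>\<^sup>+x. ennreal (\<bar>x\<bar> powr - r) * indicator {1..} x + ennreal (\<bar>x\<bar> powr - r) * indicator {..-1} x \<partial>lborel)"
    by (intro nn_integral_cong) (auto simp: indicator_def)
  also have "\<dots> = (\<integral>\<^sup>+x. ennreal (\<bar>x\<bar> powr - r) * indicator {1..} x \<partial>lborel)
       + (\<integral>\<^sup>+x. ennreal (\<bar>x\<bar> powr - r) * indicator {..-1} x \<partial>lborel)"
    by (rule nn_integral_add) auto
  finally show ?thesis
    using L R by (simp add: nn_integral_completion)
qed

text \<open>Young's inequality splits \<open>m = (m x) (1 / x)\<close> into a \<open>p\<close>-th power and a power of \<open>1 / x\<close>
  that is integrable at infinity; for \<open>p = 1\<close> only the first part is needed.\<close>

lemma weight_le_powr_add_inverse_powr: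
  fixes m x p :: real
  assumes "m > 0" "1 \<le> \<bar>x\<bar>" "1 \<le> p"
  shows "m \<le> (m * \<bar>x\<bar>) powr p + \<bar>x\<bar> powr - (1 + (if p = 1 then 1 else 1 / (p - 1)))"
proof -
  define a where "a = m * \<bar>x\<bar>"
  define b where "b = inverse \<bar>x\<bar>"
  have ab: "a > 0" "b > 0" "b \<le> 1" "m = a * b"
    using assms by (auto simp: a_def b_def field_simps)
  show ?thesis
  \<comment> \<open>The comparison decides which of the two powers dominates the product
    \<open>a * b\<close>. For \<open>p = 1\<close> the power of \<open>a\<close> equals
    \<open>1\<close> and \<open>b \<le> 1\<close>, so the first case applies.\<close>
  proof (cases "b \<le> a powr (p - 1)")
    case True
    then have "a * b \<le> a * a powr (p - 1)"
      using ab by (intro mult_left_mono) auto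
    also have "\<dots> = a powr p"
      using ab by (simp add: powr_mult_base)
    finally have "m \<le> a powr p"
      using ab(4) by simp
    then show ?thesis
      unfolding a_def by (rule order_trans) simp
  next
    case False
    then have "p \<noteq> 1" using ab by auto
    then have p: "p > 1" using assms by simp
    have "a = (a powr (p - 1)) powr (1 / (p - 1))"
      using ab p by (simp add: powr_powr)
    also have "\<dots> \<le> b powr (1 / (p - 1))"
      using False ab p by (intro powr_mono2) auto
    finally have "a * b \<le> b powr (1 / (p - 1)) * b"
      using ab by (intro mult_right_mono) auto
    also have "\<dots> = b powr (1 + 1 / (p - 1))"
      using ab by (simp add: powr_add)
    also have "\<dots> = \<bar>x\<bar> powr - (1 + 1 / (p - 1))"
      using assms(2) unfolding b_def powr_minus by (subst inverse_powr) auto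
    finally have "m \<le> \<bar>x\<bar> powr - (1 + (if p = 1 then 1 else 1 / (p - 1)))"
      using ab(4) \<open>p \<noteq> 1\<close> by simp
    then show ?thesis
      by (rule order_trans) simp
  qed
qed

text \<open>Linear growth of \<open>z\<close> bounds \<open>(m x * \<bar>x\<bar>) powr p\<close> by
  a multiple of the weighted integrand, and the remaining power of \<open>\<bar>x\<bar>\<close> is
  integrable away from \<open>0\<close>. Read backwards: on a set where the weight has infinite
  integral, no function of linear growth is in the weighted space.\<close>

lemma nn_integral_weight_finite:
  fixes m z :: "real \<Rightarrow> real"
  assumes m: "continuous_on UNIV m" "\<And>x. m x > 0" and p: "1 \<le> p"
    and int: "integrable lebesgue (\<lambda>x. \<bar>m x * z x\<bar> powr p)"
    and S: "S \<in> sets lebesgue" "\<And>x. x \<in> S \<Longrightarrow> 1 \<le> \<bar>x\<bar>"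
    and "c > 0" and z: "\<And>x. x \<in> S \<Longrightarrow> c * \<bar>x\<bar> \<le> \<bar>z x\<bar>"
  shows "(\<integral>\<^sup>+x\<in>S. ennreal (m x) \<partial>lebesgue) < \<infinity>"
proof -
  \<comment> \<open>For \<open>p > 1\<close> this is the exponent conjugate to \<open>p\<close>; for
    \<open>p = 1\<close> any number above \<open>1\<close> would serve.\<close>
  define r where "r = 1 + (if p = 1 then 1 else 1 / (p - 1))"
  have r: "r > 1" using p by (auto simp: r_def)
  let ?f = "\<lambda>x. ennreal ((1 / c) powr p * \<bar>m x * z x\<bar> powr p)"
  let ?g = "\<lambda>x. ennreal (\<bar>x\<bar> powr - r) * indicator {x. 1 \<le> \<bar>x\<bar>} x"
  have "ennreal (m x) * indicator S x \<le> ?f x + ?g x" for x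
  proof (cases "x \<in> S")
    case True
    have "m x \<le> (m x * \<bar>x\<bar>) powr p + \<bar>x\<bar> powr - r"
      unfolding r_def by (rule weight_le_powr_add_inverse_powr) (use m p S True in auto)
    also have "m x * \<bar>x\<bar> \<le> (1 / c) * \<bar>m x * z x\<bar>"
      using mult_left_mono[OF z[OF True], of "m x"] m(2)[of x] \<open>c > 0\<close>
      by (simp add: field_simps abs_mult)
    then have "(m x * \<bar>x\<bar>) powr p \<le> ((1 / c) * \<bar>m x * z x\<bar>) powr p"
      using p m(2)[of x] by (intro powr_mono2) auto
    also have "\<dots> = (1 / c) powr p * \<bar>m x * z x\<bar> powr p"
      using \<open>c > 0\<close> by (subst powr_mult) auto
    finally have "m x \<le> (1 / c) powr p * \<bar>m x * z x\<bar> powr p + \<bar>x\<bar> powr - r" by simp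
    then have "ennreal (m x) \<le> ennreal ((1 / c) powr p * \<bar>m x * z x\<bar> powr p + \<bar>x\<bar> powr - r)"
      by (rule ennreal_leI)
    also have "\<dots> = ?f x + ennreal (\<bar>x\<bar> powr - r)"
      by (rule ennreal_plus) auto
    finally show ?thesis using True S by simp
  qed simp
  then have "(\<integral>\<^sup>+x\<in>S. ennreal (m x) \<partial>lebesgue) \<le> (\<integral>\<^sup>+x. ?f x + ?g x \<partial>lebesgue)"
    by (intro nn_integral_mono) auto
  also have "\<dots> = (\<integral>\<^sup>+x. ?f x \<partial>lebesgue) + (\<integral>\<^sup>+x. ?g x \<partial>lebesgue)"
  proof (rule nn_integral_add)
    show "?f \<in> borel_measurable lebesgue"
      using borel_measurable_integrable[OF int] by measurable
    have "?g \<in> borel_measurable lborel" by measurable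
    then show "?g \<in> borel_measurable lebesgue" by (rule measurable_completion)
  qed
  also have "\<dots> < \<infinity>"
  proof -
    have "integrable lebesgue (\<lambda>x. (1 / c) powr p * \<bar>m x * z x\<bar> powr p)"
      using int by simp
    then have "(\<integral>\<^sup>+x. ?f x \<partial>lebesgue) < \<infinity>"
      by (subst nn_integral_eq_integral) auto
    with nn_integral_abs_powr_finite[OF r] show ?thesis by simp
  qed
  finally show ?thesis .
qed

lemma nn_integral_continuous_Icc_finite:
  fixes m :: "real \<Rightarrow> real"
  assumes "continuous_on UNIV m"
  shows "(\<integral>\<^sup>+x\<in>{a..b}. ennreal (m x) \<partial>lebesgue) < \<infinity>"
proof -
  have "m absolutely_integrable_on {a..b}"
    using assms by (intro absolutely_integrable_continuous_real) (auto intro: continuous_on_subset)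
  then have "integrable lebesgue (\<lambda>x. indicator {a..b} x *\<^sub>R m x)"
    by (simp add: set_integrable_def)
  then have "(\<integral>\<^sup>+x. ennreal (norm (indicator {a..b} x *\<^sub>R m x)) \<partial>lebesgue) < \<infinity>"
    by (simp add: integrable_iff_bounded)
  then show ?thesis
    by (rule le_less_trans[rotated]) (auto intro!: nn_integral_mono simp: indicator_def ennreal_leI)
qed

section \<open>Solutions and the Green function\<close>

lemma is_solution_has_derivative:
  assumes "is_solution q f y"
  shows "(y has_real_derivative deriv y x) (at x)"
  using assms by (simp add: is_solution_def DERIV_deriv_iff_real_differentiable)

lemma is_solution_AE_second_derivative:
  assumes "is_solution q f y"
  shows "AE x in lebesgue. (deriv y has_real_derivative q x * y x - f x) (at x)"
proof -
  have "AE x in lebesgue. deriv y differentiable at x \<and> - deriv (deriv y) x + q x * y x = f x"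
    using assms by (simp add: is_solution_def)
  then show ?thesis
  proof eventually_elim
    case (elim x)
    then have "deriv (deriv y) x = q x * y x - f x" by simp
    with elim show ?case
      by (metis DERIV_deriv_iff_real_differentiable)
  qed
qed

lemma is_solutionI:
  assumes y: "\<And>x. (y has_real_derivative h x) (at x)"
    and ac: "loc_abs_continuous h"
    and ae: "AE x in lebesgue. (h has_real_derivative q x * y x - f x) (at x)"
  shows "is_solution q f y"
proof -
  have h: "deriv y = h"
    using y by (auto simp: fun_eq_iff intro: DERIV_imp_deriv)
  have "loc_abs_continuous y"
    using y loc_abs_continuous_imp_continuous_on[OF ac] by (rule continuous_derivative_imp_loc_abs_continuous)
  moreover have "AE x in lebesgue. h differentiable at x \<and> - deriv h x + q x * y x = f x"
    using ae
  proof eventually_elim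
    case (elim x)
    then show ?case
      using DERIV_imp_deriv[OF elim] by (auto simp: real_differentiable_def)
  qed
  ultimately show ?thesis
    using y ac by (auto simp: is_solution_def h real_differentiable_def)
qed

lemma is_solution_diff:
  assumes "is_solution q f y" "is_solution q g z"
  shows "is_solution q (\<lambda>x. f x - g x) (\<lambda>x. y x - z x)"
proof (rule is_solutionI)
  show "((\<lambda>x. y x - z x) has_real_derivative deriv y x - deriv z x) (at x)" for x
    by (intro DERIV_diff is_solution_has_derivative[OF assms(1)] is_solution_has_derivative[OF assms(2)])
  show "loc_abs_continuous (\<lambda>x. deriv y x - deriv z x)"
    using assms by (intro loc_abs_continuous_diff) (auto simp: is_solution_def)
  show "AE x in lebesgue. ((\<lambda>x. deriv y x - deriv z x) has_real_derivative
          q x * (y x - z x) - (f x - g x)) (at x)"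
    using is_solution_AE_second_derivative[OF assms(1)] is_solution_AE_second_derivative[OF assms(2)]
  proof eventually_elim
    case (elim x)
    from DERIV_diff[OF elim] show ?case by (simp add: algebra_simps)
  qed
qed

text \<open>Lagrange's identity: in the derivative of the Wronskian the terms with \<open>q\<close>
  cancel and \<open>f x * w x\<close> remains. For \<open>f = 0\<close> the Wronskian is
  constant.\<close>

lemma wronskian_has_integral:
  assumes z: "is_solution q f z" and w: "is_solution q (\<lambda>_. 0) w" and "a \<le> b"
  shows "((\<lambda>x. f x * w x) has_integral
     (z b * deriv w b - deriv z b * w b) - (z a * deriv w a - deriv z a * w a)) {a..b}"
proof (rule loc_abs_continuous_has_integral_derivative[OF _ _ \<open>a \<le> b\<close>])
  show "loc_abs_continuous (\<lambda>x. z x * deriv w x - deriv z x * w x)"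
    using z w by (intro loc_abs_continuous_diff loc_abs_continuous_mult) (auto simp: is_solution_def)
  show "AE x in lebesgue. ((\<lambda>x. z x * deriv w x - deriv z x * w x) has_real_derivative f x * w x) (at x)"
    using is_solution_AE_second_derivative[OF z] is_solution_AE_second_derivative[OF w]
  proof eventually_elim
    case (elim x)
    have "((\<lambda>x. z x * deriv w x - deriv z x * w x) has_real_derivative
        (deriv z x * deriv w x + (q x * w x - 0) * z x) -
        ((q x * z x - f x) * w x + deriv w x * deriv z x)) (at x)"
      by (intro DERIV_diff DERIV_mult elim is_solution_has_derivative[OF z] is_solution_has_derivative[OF w])
    then show ?case
      by (rule DERIV_cong) (simp add: algebra_simps)
  qed
qed

lemma deriv_nonneg_solution_mono:
  assumes q: "AE x in lebesgue. 0 \<le> q x" and w: "is_solution q (\<lambda>_. 0) w" "\<And>x. 0 \<le> w x"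
    and "x \<le> y"
  shows "deriv w x \<le> deriv w y"
proof -
  \<comment> \<open>The absolute value agrees with \<open>q\<close> almost everywhere and makes the
    integrand nonnegative at every point, as the last comparison requires.\<close>
  have "AE x in lebesgue. (deriv w has_real_derivative \<bar>q x\<bar> * w x) (at x)"
    using is_solution_AE_second_derivative[OF w(1)] q by eventually_elim simp
  then have "((\<lambda>x. \<bar>q x\<bar> * w x) has_integral deriv w y - deriv w x) {x..y}"
    using w(1) \<open>x \<le> y\<close> by (intro loc_abs_continuous_has_integral_derivative) (auto simp: is_solution_def)
  then have "0 \<le> deriv w y - deriv w x"
    by (rule has_integral_nonneg) (use w(2) in simp)
  then show ?thesis by simp
qed

text \<open>Serves to upgrade a derivative that is known only almost everywhere: once
  \<open>y\<close> is the integral of a continuous \<open>h\<close>, it is differentiable at every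
  point, as a solution has to be.\<close>

lemma has_derivative_if_has_integral_continuous:
  fixes h y :: "real \<Rightarrow> real"
  assumes y: "\<And>a b. a \<le> b \<Longrightarrow> (h has_integral y b - y a) {a..b}" and h: "continuous_on UNIV h"
  shows "(y has_real_derivative h x) (at x)"
proof -
  have "((\<lambda>s. integral {x-1..s} h) has_real_derivative h x) (at x within {x-1..x+1})"
    using h by (intro integral_has_real_derivative) (auto intro: continuous_on_subset)
  then have "((\<lambda>s. y (x-1) + integral {x-1..s} h) has_real_derivative 0 + h x) (at x within {x-1..x+1})"
    by (intro DERIV_add DERIV_const)
  moreover have "y (x-1) + integral {x-1..s} h = y s" if "s \<in> {x-1..x+1}" for s
    using integral_unique[OF y[of "x-1" s]] that by simp
  ultimately have "(y has_real_derivative h x) (at x within {x-1..x+1})"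
    unfolding has_field_derivative_def
    by (intro has_derivative_transform[where g = y and f = "\<lambda>s. y (x-1) + integral {x-1..s} h"]) auto
  moreover have "at x within {x-1..x+1} = at x"
    by (rule at_within_interior) simp
  ultimately show ?thesis by simp
qed

section \<open>Tail integrals as functions of their endpoint\<close>

lemma set_integral_Ioc_has_integral:
  fixes h :: "real \<Rightarrow> real"
  assumes "set_integrable lebesgue {x<..y} h"
  shows "(h has_integral (LINT t:{x<..y}|lebesgue. h t)) {x..y}"
proof -
  have "negligible {t \<in> {x<..y} - {x..y}. h t \<noteq> 0}" "negligible {t \<in> {x..y} - {x<..y}. h t \<noteq> 0}"
    by (auto intro: negligible_subset[of "{x}"])
  with has_integral_set_lebesgue[OF assms] show ?thesis
    using has_integral_spike_set_eq by blast
qed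

lemma lower_tail_integral_has_integral:
  fixes h :: "real \<Rightarrow> real"
  assumes h: "\<And>x. set_integrable lebesgue {..x} h" and "x \<le> y"
  shows "(h has_integral (LINT t:{..y}|lebesgue. h t) - (LINT t:{..x}|lebesgue. h t)) {x..y}"
proof -
  have sub: "set_integrable lebesgue {x<..y} h"
    by (rule set_integrable_subset[OF h[of y]]) auto
  have "{..y} = {..x} \<union> {x<..y}" using \<open>x \<le> y\<close> by auto
  then have "(LINT t:{..y}|lebesgue. h t) = (LINT t:{..x}|lebesgue. h t) + (LINT t:{x<..y}|lebesgue. h t)"
    by (simp only: set_integral_Un[OF _ h[of x] sub] ivl_disj_int)
  with set_integral_Ioc_has_integral[OF sub] show ?thesis by simp
qed

lemma upper_tail_integral_has_integral:
  fixes h :: "real \<Rightarrow> real"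
  assumes h: "\<And>x. set_integrable lebesgue {x<..} h" and "x \<le> y"
  shows "((\<lambda>t. - h t) has_integral (LINT t:{y<..}|lebesgue. h t) - (LINT t:{x<..}|lebesgue. h t)) {x..y}"
proof -
  have sub: "set_integrable lebesgue {x<..y} h"
    by (rule set_integrable_subset[OF h[of x]]) auto
  have "{x<..} = {y<..} \<union> {x<..y}" using \<open>x \<le> y\<close> by auto
  then have "(LINT t:{x<..}|lebesgue. h t) = (LINT t:{y<..}|lebesgue. h t) + (LINT t:{x<..y}|lebesgue. h t)"
    using set_integral_Un[OF _ h[of y] sub] by (simp add: Int_def)
  with has_integral_neg[OF set_integral_Ioc_has_integral[OF sub]] show ?thesis by simp
qed

text \<open>Local integrability lets the endpoint of a convergent tail move freely; this carries
  convergence of the Green integral from one point to all others.\<close>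

lemma set_integrable_lower_tail_extend:
  fixes h :: "real \<Rightarrow> real"
  assumes "\<And>a b. h absolutely_integrable_on {a..b}" "set_integrable lebesgue {..x} h"
  shows "set_integrable lebesgue {..y} h"
proof -
  have "set_integrable lebesgue ({..x} \<union> {x..y}) h"
    using assms by (intro set_integrable_Un) auto
  then show ?thesis by (rule set_integrable_subset) auto
qed

lemma set_integrable_upper_tail_extend:
  fixes h :: "real \<Rightarrow> real"
  assumes "\<And>a b. h absolutely_integrable_on {a..b}" "set_integrable lebesgue {x<..} h"
  shows "set_integrable lebesgue {y<..} h"
proof -
  have "set_integrable lebesgue ({x<..} \<union> {y..x}) h"
    using assms by (intro set_integrable_Un) auto
  then show ?thesis by (rule set_integrable_subset) auto
qed

section \<open>The fundamental system: coefficients of solutions and linear growth\<close>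

locale principal_solutions =
  fixes q u v :: "real \<Rightarrow> real"
  assumes q_nonneg: "AE x in lebesgue. 0 \<le> q x"
    and system: "principal_system q u v"
begin

lemma solution_u: "is_solution q (\<lambda>_. 0) u" and solution_v: "is_solution q (\<lambda>_. 0) v"
  and u_pos: "u x > 0" and v_pos: "v x > 0" and deriv_u_neg: "deriv u x < 0" and deriv_v_pos: "deriv v x > 0"
  and wronskian: "deriv v x * u x - deriv u x * v x = 1"
  and lim_bot: "((\<lambda>x. v x / u x) \<longlongrightarrow> 0) at_bot" and lim_top: "((\<lambda>x. u x / v x) \<longlongrightarrow> 0) at_top"
  using system by (auto simp: principal_system_def)

lemmas DERIV_u = is_solution_has_derivative[OF solution_u]
lemmas DERIV_v = is_solution_has_derivative[OF solution_v]

lemma ac_u: "loc_abs_continuous u" and ac_v: "loc_abs_continuous v"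
  and ac_deriv_u: "loc_abs_continuous (deriv u)" and ac_deriv_v: "loc_abs_continuous (deriv v)"
  using solution_u solution_v by (auto simp: is_solution_def)

lemma cont_u: "continuous_on S u" and cont_v: "continuous_on S v"
  by (intro loc_abs_continuous_imp_continuous_on ac_u ac_v)+

text \<open>By Cramer's rule the coefficients are, up to sign, the Wronskians of \<open>z\<close>
  with \<open>v\<close> and with \<open>u\<close>, which are constant. Normalising the Wronskian of
  the system to \<open>1\<close> removes the denominator.\<close>

lemma homogeneous_solution_decomp:
  assumes "is_solution q (\<lambda>_. 0) z"
  obtains P Q where "\<And>x. z x = P * u x + Q * v x"
proof -
  define Wv where "Wv x = z x * deriv v x - deriv z x * v x" for x
  define Wu where "Wu x = z x * deriv u x - deriv z x * u x" for x
  have const: "z x * deriv w x - deriv z x * w x = z 0 * deriv w 0 - deriv z 0 * w 0"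
    if w: "is_solution q (\<lambda>_. 0) w" for w x
  proof -
    have "z b * deriv w b - deriv z b * w b = z a * deriv w a - deriv z a * w a" if "a \<le> b" for a b
      using wronskian_has_integral[OF assms w that] has_integral_0 has_integral_unique by fastforce
    from this[of 0 x] this[of x 0] show ?thesis by linarith
  qed
  have "z x = Wv 0 * u x + (- Wu 0) * v x" for x
  proof -
    have "z x = z x * (deriv v x * u x - deriv u x * v x)"
      by (simp add: wronskian)
    also have "\<dots> = Wv x * u x + (- Wu x) * v x"
      by (simp add: Wv_def Wu_def algebra_simps)
    also have "\<dots> = Wv 0 * u x + (- Wu 0) * v x"
      using const[OF solution_v, of x] const[OF solution_u, of x] by (simp add: Wv_def Wu_def)
    finally show ?thesis .
  qed
  with that show ?thesis by blast
qed

lemma u_growth: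
  assumes "x \<le> 0"
  shows "- deriv u 0 * \<bar>x\<bar> \<le> u x"
proof (cases "x = 0")
  case True
  then show ?thesis using u_pos[of x] by simp
next
  case False
  with assms obtain c where c: "x < c" "c < 0" "u 0 - u x = (0 - x) * deriv u c"
    using MVT2[of x 0 u "deriv u"] DERIV_u by auto
  have "deriv u c \<le> deriv u 0"
    using deriv_nonneg_solution_mono[OF q_nonneg solution_u] u_pos c by (meson less_imp_le)
  then have "u 0 - u x \<le> (0 - x) * deriv u 0"
    unfolding c(3) using assms by (intro mult_left_mono) auto
  then show ?thesis
    using u_pos[of 0] assms by (simp add: algebra_simps)
qed

lemma v_growth:
  assumes "0 \<le> x"
  shows "deriv v 0 * \<bar>x\<bar> \<le> v x"
proof (cases "x = 0")
  case True
  then show ?thesis using v_pos[of x] by simp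
next
  case False
  with assms obtain c where c: "0 < c" "c < x" "v x - v 0 = (x - 0) * deriv v c"
    using MVT2[of 0 x v "deriv v"] DERIV_v by auto
  have "deriv v 0 \<le> deriv v c"
    using deriv_nonneg_solution_mono[OF q_nonneg solution_v] v_pos c by (meson less_imp_le)
  then have "(x - 0) * deriv v 0 \<le> v x - v 0"
    unfolding c(3) using assms by (intro mult_left_mono) auto
  then show ?thesis
    using v_pos[of 0] assms by (simp add: algebra_simps)
qed

section \<open>The Green kernel, convergence of its integral, and variation of constants\<close>

definition green :: "real \<Rightarrow> real \<Rightarrow> real" where
  "green = (\<lambda>x t. if x \<ge> t then u x * v t else u t * v x)"

lemma green_pos: "green x t > 0"
  by (simp add: green_def u_pos v_pos)

lemma green_mult_split:
  "green x t * f t = u x * (indicator {..x} t *\<^sub>R (v t * f t)) + v x * (indicator {x<..} t *\<^sub>R (u t * f t))"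
  by (simp add: green_def indicator_def)

text \<open>For fixed \<open>x\<close> the factors \<open>u x\<close> and \<open>v x\<close> are
  positive constants, so convergence concerns two tails whose integrands no longer contain
  \<open>x\<close>. The diagonal goes to the lower tail, which keeps the tails disjoint.\<close>

lemma integrable_green_iff:
  "integrable lebesgue (\<lambda>t. green x t * f t) \<longleftrightarrow>
     set_integrable lebesgue {..x} (\<lambda>t. v t * f t) \<and> set_integrable lebesgue {x<..} (\<lambda>t. u t * f t)"
proof
  assume int: "integrable lebesgue (\<lambda>t. green x t * f t)"
  have "integrable lebesgue (\<lambda>t. (1 / u x) * (indicator {..x} t *\<^sub>R (green x t * f t)))"
    by (intro integrable_mult_right integrable_mult_indicator int) auto
  moreover have "(1 / u x) * (indicator {..x} t *\<^sub>R (green x t * f t)) = indicator {..x} t *\<^sub>R (v t * f t)" for t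
    using u_pos[of x] by (simp add: green_def indicator_def)
  moreover have "integrable lebesgue (\<lambda>t. (1 / v x) * (indicator {x<..} t *\<^sub>R (green x t * f t)))"
    by (intro integrable_mult_right integrable_mult_indicator int) auto
  moreover have "(1 / v x) * (indicator {x<..} t *\<^sub>R (green x t * f t)) = indicator {x<..} t *\<^sub>R (u t * f t)" for t
    using v_pos[of x] by (simp add: green_def indicator_def)
  ultimately show "set_integrable lebesgue {..x} (\<lambda>t. v t * f t) \<and> set_integrable lebesgue {x<..} (\<lambda>t. u t * f t)"
    by (simp add: set_integrable_def)
next
  assume "set_integrable lebesgue {..x} (\<lambda>t. v t * f t) \<and> set_integrable lebesgue {x<..} (\<lambda>t. u t * f t)"
  then show "integrable lebesgue (\<lambda>t. green x t * f t)"
    unfolding green_mult_split set_integrable_def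
    by (intro Bochner_Integration.integrable_add integrable_mult_right) auto
qed

lemma integral_green:
  assumes "integrable lebesgue (\<lambda>t. green x t * f t)"
  shows "(LINT t|lebesgue. green x t * f t) =
    u x * (LINT t:{..x}|lebesgue. v t * f t) + v x * (LINT t:{x<..}|lebesgue. u t * f t)"
  using assms unfolding integrable_green_iff
  unfolding green_mult_split set_integrable_def set_lebesgue_integral_def
  by (subst Bochner_Integration.integral_add) auto

context
  fixes f :: "real \<Rightarrow> real" and x\<^sub>0 :: real
  assumes f_loc: "\<And>a b. f absolutely_integrable_on {a..b}"
    and int_x0: "integrable lebesgue (\<lambda>t. green x\<^sub>0 t * f t)"
begin

lemma loc_integrable_uf: "(\<lambda>t. u t * f t) absolutely_integrable_on {a..b}"
  and loc_integrable_vf: "(\<lambda>t. v t * f t) absolutely_integrable_on {a..b}"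
  by (intro absolutely_integrable_continuous_mult cont_u cont_v f_loc)+

lemma lower_tail_integrable: "set_integrable lebesgue {..x} (\<lambda>t. v t * f t)"
  and upper_tail_integrable: "set_integrable lebesgue {x<..} (\<lambda>t. u t * f t)"
  using int_x0 set_integrable_lower_tail_extend[OF loc_integrable_vf]
    set_integrable_upper_tail_extend[OF loc_integrable_uf]
  unfolding integrable_green_iff by blast+

text \<open>The tails at \<open>x\<close> and at \<open>x\<^sub>0\<close> differ by integrals over
  bounded intervals. This matters because boundedness of the operator supplies convergence only
  almost everywhere.\<close>

lemma integrable_green: "integrable lebesgue (\<lambda>t. green x t * f t)"
  unfolding integrable_green_iff using lower_tail_integrable upper_tail_integrable by blast

text \<open>Variation of constants: the terms containing \<open>f\<close> cancel in the first derivative, and the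
  Wronskian leaves exactly \<open>- f\<close> in the second one.\<close>

lemma green_is_solution: "is_solution q f (\<lambda>x. LINT t|lebesgue. green x t * f t)"
proof -
  define A where "A x = (LINT t:{..x}|lebesgue. v t * f t)" for x
  define B where "B x = (LINT t:{x<..}|lebesgue. u t * f t)" for x
  define y where "y x = u x * A x + v x * B x" for x
  define h where "h x = deriv u x * A x + deriv v x * B x" for x
  note A = lower_tail_integral_has_integral[OF lower_tail_integrable, folded A_def]
  note B = upper_tail_integral_has_integral[OF upper_tail_integrable, folded B_def]
  have neg: "(\<lambda>t. - (u t * f t)) absolutely_integrable_on {a..b}" for a b
    using loc_integrable_uf[of a b] by (simp add: set_integrable_def)
  have acA: "loc_abs_continuous A" and acB: "loc_abs_continuous B"
    using indefinite_integral_loc_abs_continuous[OF loc_integrable_vf A]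
      indefinite_integral_loc_abs_continuous[OF neg B] by blast+
  have A': "AE x in lebesgue. (A has_real_derivative v x * f x) (at x)"
    by (rule indefinite_integral_has_derivative_AE[OF A])
  have B': "AE x in lebesgue. (B has_real_derivative - (u x * f x)) (at x)"
    by (rule indefinite_integral_has_derivative_AE[OF B])
  have acy: "loc_abs_continuous y" and ach: "loc_abs_continuous h"
    unfolding y_def[abs_def] h_def[abs_def]
    by (intro loc_abs_continuous_add loc_abs_continuous_mult ac_u ac_v ac_deriv_u ac_deriv_v acA acB)+
  have "AE x in lebesgue. (y has_real_derivative h x) (at x)"
    using A' B'
  proof eventually_elim
    case (elim x)
    have "(y has_real_derivative (deriv u x * A x + v x * f x * u x) +
        (deriv v x * B x + - (u x * f x) * v x)) (at x)"
      unfolding y_def[abs_def] by (intro DERIV_add DERIV_mult DERIV_u DERIV_v elim)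
    then show ?case
      by (rule DERIV_cong) (simp add: h_def algebra_simps)
  qed
  \<comment> \<open>The tails are known to be differentiable only almost everywhere. But
    \<open>y\<close> is locally absolutely continuous and \<open>h\<close> is continuous, so
    \<open>y\<close> is the integral of \<open>h\<close> and has this derivative at every
    point.\<close>
  then have "(y has_real_derivative h x) (at x)" for x
    by (intro has_derivative_if_has_integral_continuous loc_abs_continuous_has_integral_derivative
          loc_abs_continuous_imp_continuous_on acy ach)
  moreover have "AE x in lebesgue. (h has_real_derivative q x * y x - f x) (at x)"
    using A' B' is_solution_AE_second_derivative[OF solution_u] is_solution_AE_second_derivative[OF solution_v]
  proof eventually_elim
    case (elim x)
    have "(h has_real_derivative ((q x * u x - 0) * A x + v x * f x * deriv u x) +
        ((q x * v x - 0) * B x + - (u x * f x) * deriv v x)) (at x)"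
      unfolding h_def[abs_def] by (intro DERIV_add DERIV_mult elim)
    moreover have "((q x * u x - 0) * A x + v x * f x * deriv u x) +
        ((q x * v x - 0) * B x + - (u x * f x) * deriv v x) =
        q x * y x - f x * (deriv v x * u x - deriv u x * v x)"
      by (simp add: y_def algebra_simps)
    ultimately show ?case
      by (simp add: wronskian)
  qed
  ultimately have "is_solution q f y"
    using ach by (intro is_solutionI)
  moreover have "y = (\<lambda>x. LINT t|lebesgue. green x t * f t)"
    by (simp add: fun_eq_iff y_def A_def B_def integral_green[OF integrable_green])
  ultimately show ?thesis by simp
qed

end

end

section \<open>Uniqueness in the weighted space\<close>

lemma abs_diff_powr_le:
  fixes a b p :: real
  assumes "0 \<le> p"
  shows "\<bar>a - b\<bar> powr p \<le> 2 powr p * (\<bar>a\<bar> powr p + \<bar>b\<bar> powr p)"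
proof -
  have "\<bar>a - b\<bar> powr p \<le> (2 * max (\<bar>a\<bar>) (\<bar>b\<bar>)) powr p"
    using assms by (intro powr_mono2) auto
  also have "\<dots> = 2 powr p * max (\<bar>a\<bar>) (\<bar>b\<bar>) powr p"
    by (simp add: powr_mult)
  also have "\<dots> \<le> 2 powr p * (\<bar>a\<bar> powr p + \<bar>b\<bar> powr p)"
    by (intro mult_left_mono) (auto simp: max_def)
  finally show ?thesis .
qed

text \<open>Frees norm inequalities from their roots, so that limit theorems for integrals apply;
  the constant turns into \<open>c powr p\<close>.\<close>

lemma root_le_mult_root_iff:
  fixes a b c p :: real
  assumes "0 \<le> a" "0 \<le> b" "0 \<le> c" "0 < p"
  shows "a powr (1 / p) \<le> c * b powr (1 / p) \<longleftrightarrow> a \<le> c powr p * b"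
proof -
  have "c * b powr (1 / p) = (c powr p * b) powr (1 / p)"
    using assms by (simp add: powr_mult powr_powr)
  moreover have "a powr (1 / p) \<le> d powr (1 / p) \<longleftrightarrow> a \<le> d" if "0 \<le> d" for d
    using assms that powr_less_mono2[of "1 / p" d a] powr_mono2[of "1 / p" a d]
    by (cases "a \<le> d") auto
  ultimately show ?thesis
    using assms by simp
qed

text \<open>Fatou's lemma: for nonnegative functions a uniform bound on the integrals replaces a
  dominating function and yields integrability of the limit as well.\<close>

lemma integrable_limit_of_bounded_integrals:
  fixes s :: "nat \<Rightarrow> 'a \<Rightarrow> real"
  assumes int: "\<And>n. integrable M (s n)" and nonneg: "\<And>n x. 0 \<le> s n x"
    and lim: "\<And>x. (\<lambda>n. s n x) \<longlonglongrightarrow> f x" and K: "\<And>n. integral\<^sup>L M (s n) \<le> K"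
  shows "integrable M f" "integral\<^sup>L M f \<le> K"
proof -
  have f_meas: "f \<in> borel_measurable M"
    by (rule borel_measurable_LIMSEQ_real[OF lim]) (use int in auto)
  have f_nonneg: "0 \<le> f x" for x
    by (rule LIMSEQ_le_const[OF lim]) (use nonneg in auto)
  have K0: "0 \<le> K"
    by (rule order_trans[OF Bochner_Integration.integral_nonneg K[of 0]]) (rule nonneg)
  have "(\<integral>\<^sup>+x. ennreal (f x) \<partial>M) = (\<integral>\<^sup>+x. liminf (\<lambda>n. ennreal (s n x)) \<partial>M)"
    using lim_imp_Liminf[OF _ tendsto_ennrealI[OF lim]] by simp
  also have "\<dots> \<le> liminf (\<lambda>n. \<integral>\<^sup>+x. ennreal (s n x) \<partial>M)"
    by (rule nn_integral_liminf) (use int in auto)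
  also have "\<dots> \<le> liminf (\<lambda>n. ennreal K)"
  proof (intro Liminf_mono always_eventually allI)
    fix n
    have "(\<integral>\<^sup>+x. ennreal (s n x) \<partial>M) = ennreal (integral\<^sup>L M (s n))"
      by (rule nn_integral_eq_integral[OF int]) (use nonneg in auto)
    then show "(\<integral>\<^sup>+x. ennreal (s n x) \<partial>M) \<le> ennreal K"
      using K[of n] by (simp add: ennreal_leI)
  qed
  also have "\<dots> = ennreal K" by (simp add: Liminf_const)
  finally have le: "(\<integral>\<^sup>+x. ennreal (f x) \<partial>M) \<le> ennreal K" .
  show int_f: "integrable M f"
    by (rule integrableI_nonneg[OF f_meas]) (use f_nonneg le in \<open>auto simp: less_top[symmetric] top_unique\<close>)
  show "integral\<^sup>L M f \<le> K"
    using le nn_integral_eq_integral[OF int_f] f_nonneg K0 by simp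
qed

lemma Lp_norm_nonneg: "0 \<le> Lp_norm r f"
  by (simp add: Lp_norm_def)

section \<open>Green integrals of compactly supported data, and measurability\<close>

lemma (in principal_solutions) integrable_green_compact_support:
  assumes f: "\<And>a b. f absolutely_integrable_on {a..b}" and supp: "\<And>t. t \<notin> {-n<..<n} \<Longrightarrow> f t = 0"
  shows "integrable lebesgue (\<lambda>t. green x t * f t)"
proof -
  have "integrable lebesgue (\<lambda>t. w t * f t)" if "continuous_on UNIV w" for w
  proof -
    have "(\<lambda>t. w t * f t) absolutely_integrable_on {-n..n}"
      using that by (intro absolutely_integrable_continuous_mult f) (auto intro: continuous_on_subset)
    moreover have eq: "indicator {-n..n} t *\<^sub>R (w t * f t) = w t * f t" for t
      using supp[of t] by (cases "t \<in> {-n<..<n}") (auto simp: indicator_def)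
    ultimately show ?thesis by (simp only: set_integrable_def eq)
  qed
  from this[OF cont_u] this[OF cont_v] show ?thesis
    unfolding integrable_green_iff set_integrable_def
    by (intro conjI integrable_mult_indicator) auto
qed

lemma (in principal_solutions) green_measurable: "green x \<in> borel_measurable lebesgue"
proof -
  have "green x = (\<lambda>t. u x * (indicator {..x} t * v t) + v x * (indicator {x<..} t * u t))"
    by (auto simp: fun_eq_iff green_def indicator_def)
  then show ?thesis
    using continuous_on_imp_borel_measurable_lebesgue[OF cont_u] continuous_on_imp_borel_measurable_lebesgue[OF cont_v]
    by (simp only:) (intro borel_measurable_add borel_measurable_times borel_measurable_const borel_measurable_indicator; simp)
qed

text \<open>Continuity gives measurability in \<open>x\<close>: the Green integral is a solution,
  hence locally absolutely continuous.\<close>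

lemma (in principal_solutions) green_integral_measurable:
  assumes "\<And>a b. f absolutely_integrable_on {a..b}" "integrable lebesgue (\<lambda>t. green x\<^sub>0 t * f t)"
  shows "(\<lambda>x. LINT t|lebesgue. green x t * f t) \<in> borel_measurable lebesgue"
proof -
  have "loc_abs_continuous (\<lambda>x. LINT t|lebesgue. green x t * f t)"
    using green_is_solution[OF assms] by (simp add: is_solution_def)
  then show ?thesis
    by (intro continuous_on_imp_borel_measurable_lebesgue loc_abs_continuous_imp_continuous_on)
qed

section \<open>The divergent weight against growth on the two half-lines\<close>

locale weighted_principal_solutions = principal_solutions +
  fixes \<mu> :: "real \<Rightarrow> real" and p :: real
  assumes cont_\<mu>: "continuous_on UNIV \<mu>" and \<mu>_pos: "\<And>x. \<mu> x > 0" and p_ge_1: "1 \<le> p"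
    and \<mu>_lower: "(\<integral>\<^sup>+ t\<in>{..0}. ennreal (\<mu> t) \<partial>lebesgue) = \<infinity>"
    and \<mu>_upper: "(\<integral>\<^sup>+ t\<in>{0..}. ennreal (\<mu> t) \<partial>lebesgue) = \<infinity>"
begin

lemma \<mu>_measurable: "\<mu> \<in> borel_measurable lebesgue"
  by (rule continuous_on_imp_borel_measurable_lebesgue[OF cont_\<mu>])

text \<open>Moves the end of a half-line across a bounded interval, on which the continuous weight
  has finite integral; the divergence hypotheses speak of half-lines ending at
  \<open>0\<close>.\<close>

lemma \<mu>_finite_Un:
  assumes "S \<in> sets lebesgue" "T \<subseteq> S \<union> {a..b}" "(\<integral>\<^sup>+ t\<in>S. ennreal (\<mu> t) \<partial>lebesgue) < \<infinity>"
  shows "(\<integral>\<^sup>+ t\<in>T. ennreal (\<mu> t) \<partial>lebesgue) < \<infinity>"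
proof -
  have "(\<integral>\<^sup>+ t\<in>T. ennreal (\<mu> t) \<partial>lebesgue)
      \<le> (\<integral>\<^sup>+ t. ennreal (\<mu> t) * indicator S t + ennreal (\<mu> t) * indicator {a..b} t \<partial>lebesgue)"
    using assms(2) by (intro nn_integral_mono) (auto simp: indicator_def)
  also have "\<dots> = (\<integral>\<^sup>+ t\<in>S. ennreal (\<mu> t) \<partial>lebesgue) + (\<integral>\<^sup>+ t\<in>{a..b}. ennreal (\<mu> t) \<partial>lebesgue)"
    using assms(1) \<mu>_measurable
    by (intro nn_integral_add borel_measurable_times_ennreal borel_measurable_indicator
          measurable_compose[OF _ measurable_ennreal]) auto
  also have "\<dots> < \<infinity>"
    using assms(3) nn_integral_continuous_Icc_finite[OF cont_\<mu>] by simp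
  finally show ?thesis .
qed

text \<open>If \<open>P\<close> were nonzero, \<open>P * u x\<close> would dominate near minus
  infinity, because \<open>v x / u x\<close> tends to \<open>0\<close> there; \<open>z\<close> would
  grow at least linearly and the weight would have finite integral. The form of \<open>z\<close> is
  asked for only when \<open>x \<le> a\<close>, so that solutions with compactly supported
  right-hand side are covered too.\<close>

lemma lower_coefficient_eq_0:
  assumes int: "integrable lebesgue (\<lambda>x. \<bar>\<mu> x * z x\<bar> powr p)"
    and z: "\<And>x. x \<le> a \<Longrightarrow> z x = P * u x + Q * v x"
  shows "P = 0"
proof (rule ccontr)
  assume "P \<noteq> 0"
  have "((\<lambda>x. Q * (v x / u x)) \<longlongrightarrow> 0) at_bot"
    by (rule tendsto_mult_right_zero[OF lim_bot])
  from tendstoD[OF this, of "\<bar>P\<bar> / 2"] \<open>P \<noteq> 0\<close>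
  have "eventually (\<lambda>x. \<bar>Q * (v x / u x)\<bar> < \<bar>P\<bar> / 2) at_bot"
    by (simp only: dist_real_def diff_0_right zero_less_abs_iff half_gt_zero_iff simp_thms)
  then obtain N where N: "\<And>x. x \<le> N \<Longrightarrow> \<bar>Q * (v x / u x)\<bar> < \<bar>P\<bar> / 2"
    by (auto simp: eventually_at_bot_linorder)
  \<comment> \<open>\<open>N\<close> keeps the \<open>v\<close> part below half of the
    \<open>u\<close> part, \<open>a\<close> secures the form of \<open>z\<close>, and
    \<open>-1\<close> provides \<open>1 \<le> \<bar>x\<bar>\<close> for the weight estimate.\<close>
  define M where "M = min (min N a) (-1)"
  have "(\<integral>\<^sup>+ t\<in>{..M}. ennreal (\<mu> t) \<partial>lebesgue) < \<infinity>"
  proof (rule nn_integral_weight_finite[OF cont_\<mu> \<mu>_pos p_ge_1 int])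
    show "\<bar>P\<bar> / 2 * (- deriv u 0) > 0"
      using \<open>P \<noteq> 0\<close> deriv_u_neg[of 0] by (simp add: mult_pos_neg)
    fix x assume "x \<in> {..M}"
    then have x: "x \<le> N" "x \<le> a" "x \<le> -1" by (auto simp: M_def)
    then show "1 \<le> \<bar>x\<bar>" by simp
    have "z x = u x * (P + Q * (v x / u x))"
      using z[OF x(2)] u_pos[of x] by (simp add: field_simps)
    then have eq: "\<bar>z x\<bar> = u x * \<bar>P + Q * (v x / u x)\<bar>"
      using u_pos[of x] by (simp add: abs_mult)
    have "\<bar>P\<bar> / 2 * (- deriv u 0) * \<bar>x\<bar> \<le> \<bar>P\<bar> / 2 * u x"
      using mult_left_mono[OF u_growth, of x "\<bar>P\<bar> / 2"] x by (simp add: mult.assoc)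
    also have "\<dots> \<le> \<bar>P + Q * (v x / u x)\<bar> * u x"
      using N[OF x(1)] u_pos[of x] by (intro mult_right_mono) linarith+
    finally show "\<bar>P\<bar> / 2 * (- deriv u 0) * \<bar>x\<bar> \<le> \<bar>z x\<bar>"
      using eq by (simp add: mult.commute)
  qed auto
  then have "(\<integral>\<^sup>+ t\<in>{..0}. ennreal (\<mu> t) \<partial>lebesgue) < \<infinity>"
    by (rule \<mu>_finite_Un[where a = M and b = 0, rotated -1]) auto
  with \<mu>_lower show False by simp
qed

text \<open>The mirror image at plus infinity, where \<open>v\<close> dominates and its coefficient
  has to vanish.\<close>

lemma upper_coefficient_eq_0:
  assumes int: "integrable lebesgue (\<lambda>x. \<bar>\<mu> x * z x\<bar> powr p)"
    and z: "\<And>x. a \<le> x \<Longrightarrow> z x = P * u x + Q * v x"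
  shows "Q = 0"
proof (rule ccontr)
  assume "Q \<noteq> 0"
  have "((\<lambda>x. P * (u x / v x)) \<longlongrightarrow> 0) at_top"
    by (rule tendsto_mult_right_zero[OF lim_top])
  from tendstoD[OF this, of "\<bar>Q\<bar> / 2"] \<open>Q \<noteq> 0\<close>
  have "eventually (\<lambda>x. \<bar>P * (u x / v x)\<bar> < \<bar>Q\<bar> / 2) at_top"
    by (simp only: dist_real_def diff_0_right zero_less_abs_iff half_gt_zero_iff simp_thms)
  then obtain N where N: "\<And>x. N \<le> x \<Longrightarrow> \<bar>P * (u x / v x)\<bar> < \<bar>Q\<bar> / 2"
    by (auto simp: eventually_at_top_linorder)
  define M where "M = max (max N a) 1"
  have "(\<integral>\<^sup>+ t\<in>{M..}. ennreal (\<mu> t) \<partial>lebesgue) < \<infinity>"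
  proof (rule nn_integral_weight_finite[OF cont_\<mu> \<mu>_pos p_ge_1 int])
    show "\<bar>Q\<bar> / 2 * deriv v 0 > 0"
      using \<open>Q \<noteq> 0\<close> deriv_v_pos[of 0] by simp
    fix x assume "x \<in> {M..}"
    then have x: "N \<le> x" "a \<le> x" "1 \<le> x" by (auto simp: M_def)
    then show "1 \<le> \<bar>x\<bar>" by simp
    have "z x = v x * (Q + P * (u x / v x))"
      using z[OF x(2)] v_pos[of x] by (simp add: field_simps)
    then have eq: "\<bar>z x\<bar> = v x * \<bar>Q + P * (u x / v x)\<bar>"
      using v_pos[of x] by (simp add: abs_mult)
    have "\<bar>Q\<bar> / 2 * deriv v 0 * \<bar>x\<bar> \<le> \<bar>Q\<bar> / 2 * v x"
      using mult_left_mono[OF v_growth, of x "\<bar>Q\<bar> / 2"] x by (simp add: mult.assoc)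
    also have "\<dots> \<le> \<bar>Q + P * (u x / v x)\<bar> * v x"
      using N[OF x(1)] v_pos[of x] by (intro mult_right_mono) linarith+
    finally show "\<bar>Q\<bar> / 2 * deriv v 0 * \<bar>x\<bar> \<le> \<bar>z x\<bar>"
      using eq by (simp add: mult.commute)
  qed auto
  then have "(\<integral>\<^sup>+ t\<in>{0..}. ennreal (\<mu> t) \<partial>lebesgue) < \<infinity>"
    by (rule \<mu>_finite_Un[where a = 0 and b = M, rotated -1]) auto
  with \<mu>_upper show False by simp
qed

lemma mem_Lp_weighted_\<mu>_iff:
  "f \<in> Lp_weighted p \<mu> \<longleftrightarrow>
    f \<in> borel_measurable lebesgue \<and> integrable lebesgue (\<lambda>x. \<bar>\<mu> x * f x\<bar> powr p)"
  by (rule mem_Lp_weighted_iff) (use cont_\<mu> \<mu>_pos p_ge_1 in auto)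

lemma weighted_solution_unique:
  assumes y: "is_solution q f y" "y \<in> Lp_weighted p \<mu>" and z: "is_solution q f z" "z \<in> Lp_weighted p \<mu>"
  shows "y = z"
proof -
  have "is_solution q (\<lambda>_. 0) (\<lambda>x. y x - z x)"
    using is_solution_diff[OF y(1) z(1)] by simp
  then obtain P Q where PQ: "\<And>x. y x - z x = P * u x + Q * v x"
    using homogeneous_solution_decomp by blast
  have "integrable lebesgue (\<lambda>x. \<bar>\<mu> x * (y x - z x)\<bar> powr p)"
  proof (rule Bochner_Integration.integrable_bound)
    show "integrable lebesgue (\<lambda>x. 2 powr p * (\<bar>\<mu> x * y x\<bar> powr p + \<bar>\<mu> x * z x\<bar> powr p))"
      using y(2) z(2) by (simp add: mem_Lp_weighted_\<mu>_iff)
    show "(\<lambda>x. \<bar>\<mu> x * (y x - z x)\<bar> powr p) \<in> borel_measurable lebesgue"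
      using y(2) z(2) \<mu>_measurable
      by (auto simp: mem_Lp_weighted_\<mu>_iff intro!: measurable_abs_powr borel_measurable_times borel_measurable_diff)
    show "AE x in lebesgue. norm (\<bar>\<mu> x * (y x - z x)\<bar> powr p)
        \<le> norm (2 powr p * (\<bar>\<mu> x * y x\<bar> powr p + \<bar>\<mu> x * z x\<bar> powr p))"
      using abs_diff_powr_le[of p] p_ge_1 by (simp add: right_diff_distrib)
  qed
  then have "P = 0" "Q = 0"
    using PQ lower_coefficient_eq_0[of "\<lambda>x. y x - z x" 0 P Q]
      upper_coefficient_eq_0[of "\<lambda>x. y x - z x" 0 P Q] by blast+
  with PQ show ?thesis by (simp add: fun_eq_iff)
qed

text \<open>To the left of the support of \<open>f\<close> the Green integral is a multiple of \<open>v\<close>, to the right of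
  it a multiple of \<open>u\<close>, so the growth of \<open>u\<close> and \<open>v\<close> excludes any other solution.\<close>

lemma weighted_solution_eq_green:
  assumes f: "\<And>a b. f absolutely_integrable_on {a..b}" and supp: "\<And>t. t \<notin> {-n<..<n} \<Longrightarrow> f t = 0"
    and y: "is_solution q f y" "y \<in> Lp_weighted p \<mu>"
  shows "y x = (LINT t|lebesgue. green x t * f t)"
proof -
  define w where "w x = (LINT t|lebesgue. green x t * f t)" for x
  note int = integrable_green_compact_support[OF f supp]
  have w_eq: "w x = u x * (LINT t:{..x}|lebesgue. v t * f t) + v x * (LINT t:{x<..}|lebesgue. u t * f t)" for x
    unfolding w_def by (rule integral_green[OF int])
  have "is_solution q f w"
    unfolding w_def[abs_def] by (rule green_is_solution[OF f int])
  from is_solution_diff[OF y(1) this] obtain P Q where "\<And>x. y x - w x = P * u x + Q * v x"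
    using homogeneous_solution_decomp by auto
  then have PQ: "y x = w x + P * u x + Q * v x" for x
    by (metis add.assoc add.commute diff_add_cancel)
  have yint: "integrable lebesgue (\<lambda>x. \<bar>\<mu> x * y x\<bar> powr p)"
    using y(2) by (simp add: mem_Lp_weighted_\<mu>_iff)
  have "w x = v x * (LINT t|lebesgue. u t * f t)" if "x \<le> - n" for x
  proof -
    have "(LINT t:{..x}|lebesgue. v t * f t) = (LINT t:{..x}|lebesgue. 0)"
      using supp that by (intro set_lebesgue_integral_cong) auto
    moreover have "(LINT t:{x<..}|lebesgue. u t * f t) = (LINT t|lebesgue. u t * f t)"
      unfolding set_lebesgue_integral_def
      using supp that by (intro Bochner_Integration.integral_cong) (auto simp: indicator_def)
    ultimately show ?thesis
      by (simp add: w_eq)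
  qed
  \<comment> \<open>The Green integral only alters the coefficient of \<open>v\<close> here, so the
    criterion at minus infinity isolates \<open>P\<close>. At plus infinity the roles are
    exchanged.\<close>
  then have "y x = P * u x + (Q + (LINT t|lebesgue. u t * f t)) * v x" if "x \<le> - n" for x
    using PQ[of x] that by (simp add: algebra_simps)
  then have "P = 0" by (rule lower_coefficient_eq_0[OF yint])
  have "w x = u x * (LINT t|lebesgue. v t * f t)" if "n \<le> x" for x
  proof -
    have "(LINT t:{x<..}|lebesgue. u t * f t) = (LINT t:{x<..}|lebesgue. 0)"
      using supp that by (intro set_lebesgue_integral_cong) auto
    moreover have "(LINT t:{..x}|lebesgue. v t * f t) = (LINT t|lebesgue. v t * f t)"
      unfolding set_lebesgue_integral_def
      using supp that by (intro Bochner_Integration.integral_cong) (auto simp: indicator_def)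
    ultimately show ?thesis
      by (simp add: w_eq)
  qed
  then have "y x = (P + (LINT t|lebesgue. v t * f t)) * u x + Q * v x" if "n \<le> x" for x
    using PQ[of x] that by (simp add: algebra_simps)
  then have "Q = 0" by (rule upper_coefficient_eq_0[OF yint])
  with \<open>P = 0\<close> PQ show ?thesis by (simp add: w_def)
qed

end

section \<open>Admissibility and boundedness\<close>

context weighted_principal_solutions
begin

lemma bounded_imp_admissible:
  assumes \<theta>: "continuous_on UNIV \<theta>" "\<And>x. \<theta> x > 0"
    and bdd: "green_operator_bounded p \<mu> \<theta> green"
  shows "admissible p \<mu> \<theta> q"
proof -
  obtain C where C: "\<And>f. f \<in> Lp p \<Longrightarrow> Lp_norm p (green_operator \<mu> \<theta> green f) \<le> C * Lp_norm p f"
    and AE: "\<And>f. f \<in> Lp p \<Longrightarrow> AE x in lebesgue. integrable lebesgue (\<lambda>t. green x t / \<theta> t * f t)"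
    and Lp: "\<And>f. f \<in> Lp p \<Longrightarrow> green_operator \<mu> \<theta> green f \<in> Lp p"
    using bdd by (auto simp: green_operator_bounded_def)
  have key: "\<exists>y. y \<in> Lp_weighted p \<mu> \<and> is_solution q f y \<and>
      Lp_weighted_norm p \<mu> y \<le> C * Lp_weighted_norm p \<theta> f" if f: "f \<in> Lp_weighted p \<theta>" for f
  proof -
    \<comment> \<open>Multiplication by \<theta> preserves the norm from the weighted to the
      unweighted space and cancels the division by \<theta> in the operator.\<close>
    define \<phi> where "\<phi> t = \<theta> t * f t" for t
    define y where "y x = (LINT t|lebesgue. green x t * f t)" for x
    have "f \<in> Lp_loc p" using f by (simp add: Lp_weighted_def)
    then have floc: "f absolutely_integrable_on {a..b}" for a b
      using p_ge_1 by (rule Lp_loc_imp_absolutely_integrable)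
    have \<phi>: "\<phi> \<in> Lp p"
      using f continuous_on_imp_borel_measurable_lebesgue[OF \<theta>(1)]
      by (auto simp: Lp_def Lp_weighted_def Lp_loc_def \<phi>_def[abs_def] intro: borel_measurable_times)
    have cancel: "green x t / \<theta> t * \<phi> t = green x t * f t" for x t
      using \<theta>(2)[of t] by (simp add: \<phi>_def)
    \<comment> \<open>The line is not a null set, so almost everywhere convergence provides a point
      of convergence, and one is enough.\<close>
    have "negligible {x. \<not> integrable lebesgue (\<lambda>t. green x t * f t)}"
      using AE[OF \<phi>] by (simp only: cancel AE_lebesgue_iff_negligible)
    then obtain x\<^sub>0 where x\<^sub>0: "integrable lebesgue (\<lambda>t. green x\<^sub>0 t * f t)"
      using non_negligible_UNIV[where 'a = real] by (metis (mono_tags, lifting) UNIV_eq_I mem_Collect_eq)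
    have op: "green_operator \<mu> \<theta> green \<phi> = (\<lambda>x. \<mu> x * y x)"
      by (simp only: fun_eq_iff green_operator_def cancel y_def simp_thms)
    have "y \<in> borel_measurable lebesgue"
      unfolding y_def[abs_def] by (rule green_integral_measurable[OF floc x\<^sub>0])
    then have "y \<in> Lp_weighted p \<mu>"
      using Lp[OF \<phi>] by (simp add: mem_Lp_weighted_\<mu>_iff op Lp_def)
    moreover have "is_solution q f y"
      unfolding y_def[abs_def] by (rule green_is_solution[OF floc x\<^sub>0])
    moreover have "Lp_weighted_norm p \<mu> y \<le> C * Lp_weighted_norm p \<theta> f"
      using C[OF \<phi>] unfolding op by (simp add: Lp_weighted_norm_def \<phi>_def[abs_def])
    ultimately show ?thesis by blast
  qed
  have "\<exists>!y. y \<in> Lp_weighted p \<mu> \<and> is_solution q f y" if "f \<in> Lp_weighted p \<theta>" for f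
    using key[OF that] weighted_solution_unique by blast
  \<comment> \<open>\<open>C\<close> may be zero or negative, whereas admissibility asks for a
    positive constant.\<close>
  moreover have "Lp_weighted_norm p \<mu> y \<le> max C 1 * Lp_weighted_norm p \<theta> f"
    if f: "f \<in> Lp_weighted p \<theta>" and y: "y \<in> Lp_weighted p \<mu>" "is_solution q f y" for f y
  proof -
    have "Lp_weighted_norm p \<mu> y \<le> C * Lp_weighted_norm p \<theta> f"
      using key[OF f] weighted_solution_unique y by blast
    also have "\<dots> \<le> max C 1 * Lp_weighted_norm p \<theta> f"
      by (intro mult_right_mono) (auto simp: Lp_weighted_norm_def Lp_norm_nonneg)
    finally show ?thesis .
  qed
  ultimately show ?thesis
    unfolding admissible_def by (intro conjI ballI exI[of _ "max C 1"]) auto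
qed

section \<open>From admissibility to bounds for the Green integral\<close>

lemma admissible_imp_green_truncated_bound:
  assumes \<theta>: "continuous_on UNIV \<theta>" "\<And>x. \<theta> x > 0" and adm: "admissible p \<mu> \<theta> q"
  obtains c where "c > 0"
    "\<And>g n. \<lbrakk>g \<in> Lp_weighted p \<theta>; \<And>t. t \<notin> {-n<..<n} \<Longrightarrow> g t = 0\<rbrakk> \<Longrightarrow>
      integrable lebesgue (\<lambda>x. \<bar>\<mu> x * (LINT t|lebesgue. green x t * g t)\<bar> powr p) \<and>
      (LINT x|lebesgue. \<bar>\<mu> x * (LINT t|lebesgue. green x t * g t)\<bar> powr p)
        \<le> c powr p * (LINT x|lebesgue. \<bar>\<theta> x * g x\<bar> powr p)"
proof -
  obtain c where c: "c > 0" "\<And>g y. \<lbrakk>g \<in> Lp_weighted p \<theta>; y \<in> Lp_weighted p \<mu>; is_solution q g y\<rbrakk>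
      \<Longrightarrow> Lp_weighted_norm p \<mu> y \<le> c * Lp_weighted_norm p \<theta> g"
    using adm by (auto simp: admissible_def)
  show ?thesis
  proof (rule that[OF c(1)])
    fix g :: "real \<Rightarrow> real" and n :: real
    assume g: "g \<in> Lp_weighted p \<theta>" and supp: "\<And>t. t \<notin> {-n<..<n} \<Longrightarrow> g t = 0"
    obtain y where y: "y \<in> Lp_weighted p \<mu>" "is_solution q g y"
      using adm g by (auto simp: admissible_def)
    have gloc: "g absolutely_integrable_on {a..b}" for a b
      using g p_ge_1 by (auto simp: Lp_weighted_def intro: Lp_loc_imp_absolutely_integrable)
    \<comment> \<open>Compact support identifies the solution that admissibility provides with the
      Green integral; its norm estimate thus becomes an estimate for the kernel.\<close>
    have "y = (\<lambda>x. LINT t|lebesgue. green x t * g t)"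
      using weighted_solution_eq_green[OF gloc supp y(2,1)] by (simp add: fun_eq_iff)
    then show "integrable lebesgue (\<lambda>x. \<bar>\<mu> x * (LINT t|lebesgue. green x t * g t)\<bar> powr p) \<and>
      (LINT x|lebesgue. \<bar>\<mu> x * (LINT t|lebesgue. green x t * g t)\<bar> powr p)
        \<le> c powr p * (LINT x|lebesgue. \<bar>\<theta> x * g x\<bar> powr p)"
      using c(2)[OF g y] y(1) c(1) p_ge_1
      by (simp add: mem_Lp_weighted_\<mu>_iff Lp_weighted_norm_def Lp_norm_def root_le_mult_root_iff
          Bochner_Integration.integral_nonneg)
  qed
qed

text \<open>Convergence has to be extracted from the bound. For nonnegative data the Green integrals
  of the truncations increase and obey one common bound, so their limit is finite somewhere and
  hence everywhere; Fatou's lemma then preserves the constant.\<close>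

lemma admissible_imp_green_bound:
  assumes \<theta>: "continuous_on UNIV \<theta>" "\<And>x. \<theta> x > 0" and adm: "admissible p \<mu> \<theta> q"
  obtains c where "c > 0"
    "\<And>g. \<lbrakk>g \<in> Lp_weighted p \<theta>; \<And>t. 0 \<le> g t\<rbrakk> \<Longrightarrow>
      (\<forall>x. integrable lebesgue (\<lambda>t. green x t * g t)) \<and>
      integrable lebesgue (\<lambda>x. \<bar>\<mu> x * (LINT t|lebesgue. green x t * g t)\<bar> powr p) \<and>
      (LINT x|lebesgue. \<bar>\<mu> x * (LINT t|lebesgue. green x t * g t)\<bar> powr p)
        \<le> c powr p * (LINT x|lebesgue. \<bar>\<theta> x * g x\<bar> powr p)"
proof -
  obtain c where c: "c > 0"
    "\<And>g n. \<lbrakk>g \<in> Lp_weighted p \<theta>; \<And>t. t \<notin> {-n<..<n} \<Longrightarrow> g t = 0\<rbrakk> \<Longrightarrow>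
      integrable lebesgue (\<lambda>x. \<bar>\<mu> x * (LINT t|lebesgue. green x t * g t)\<bar> powr p) \<and>
      (LINT x|lebesgue. \<bar>\<mu> x * (LINT t|lebesgue. green x t * g t)\<bar> powr p)
        \<le> c powr p * (LINT x|lebesgue. \<bar>\<theta> x * g x\<bar> powr p)"
    using admissible_imp_green_truncated_bound[OF \<theta> adm] by blast
  show ?thesis
  proof (rule that[OF c(1)])
    fix g :: "real \<Rightarrow> real"
    assume g: "g \<in> Lp_weighted p \<theta>" and g0: "\<And>t. 0 \<le> g t"
    have mem_\<theta>: "h \<in> Lp_weighted p \<theta> \<longleftrightarrow>
        h \<in> borel_measurable lebesgue \<and> integrable lebesgue (\<lambda>x. \<bar>\<theta> x * h x\<bar> powr p)" for h
      by (rule mem_Lp_weighted_iff[OF \<theta>]) (use p_ge_1 in auto)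
    have g_meas: "g \<in> borel_measurable lebesgue"
      and g_int: "integrable lebesgue (\<lambda>x. \<bar>\<theta> x * g x\<bar> powr p)"
      using g by (auto simp: mem_\<theta>)
    have gloc: "g absolutely_integrable_on {a..b}" for a b
      using g p_ge_1 by (auto simp: Lp_weighted_def intro: Lp_loc_imp_absolutely_integrable)
    define K where "K = c powr p * (LINT x|lebesgue. \<bar>\<theta> x * g x\<bar> powr p)"
    define gn where "gn n t = indicator {-real n<..<real n} t * g t" for n t
    define y where "y n x = (LINT t|lebesgue. green x t * gn n t)" for n x
    have gn0: "0 \<le> gn n t" and gn_le: "gn n t \<le> g t" for n t
      using g0[of t] by (auto simp: gn_def indicator_def)
    have gn_mono: "gn m t \<le> gn n t" if "m \<le> n" for m n t
      using g0[of t] that by (auto simp: gn_def indicator_def)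
    have gn_lim: "(\<lambda>n. gn n t) \<longlonglongrightarrow> g t" for t
    proof (rule tendsto_eventually, rule eventually_sequentiallyI)
      fix n assume "Suc (nat \<lceil>\<bar>t\<bar>\<rceil>) \<le> n"
      then have "\<bar>t\<bar> < real n" by linarith
      then show "gn n t = g t" by (auto simp: gn_def indicator_def)
    qed
    have gn_meas: "gn n \<in> borel_measurable lebesgue" for n
      unfolding gn_def[abs_def]
      by (intro borel_measurable_times borel_measurable_indicator g_meas) auto
    have gn_powr: "\<bar>\<theta> x * gn n x\<bar> powr p \<le> \<bar>\<theta> x * g x\<bar> powr p" for n x
      using p_ge_1 gn0[of n x] gn_le[of n x] \<theta>(2)[of x] by (intro powr_mono2) (auto simp: abs_mult)
    have gn_int: "integrable lebesgue (\<lambda>x. \<bar>\<theta> x * gn n x\<bar> powr p)" for n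
      using g_int
    proof (rule Bochner_Integration.integrable_bound)
      show "(\<lambda>x. \<bar>\<theta> x * gn n x\<bar> powr p) \<in> borel_measurable lebesgue"
        using gn_meas continuous_on_imp_borel_measurable_lebesgue[OF \<theta>(1)]
        by (intro measurable_abs_powr borel_measurable_times)
    qed (use gn_powr in auto)
    have gn_mem: "gn n \<in> Lp_weighted p \<theta>" for n
      using gn_meas gn_int by (simp add: mem_\<theta>)
    have gn_supp: "gn n t = 0" if "t \<notin> {-real n<..<real n}" for n t
      using that by (simp add: gn_def)
    have gn_loc: "gn n absolutely_integrable_on {a..b}" for n a b
      using gn_mem p_ge_1 by (auto simp: Lp_weighted_def intro: Lp_loc_imp_absolutely_integrable)
    have y_int: "integrable lebesgue (\<lambda>t. green x t * gn n t)" for n x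
      by (rule integrable_green_compact_support[OF gn_loc gn_supp])
    have y0: "0 \<le> y n x" for n x
      unfolding y_def using gn0 green_pos[of x] by (intro Bochner_Integration.integral_nonneg) (simp add: less_imp_le)
    have y_mono: "y m x \<le> y n x" if "m \<le> n" for m n x
      unfolding y_def using gn_mono[OF that] green_pos[of x]
      by (intro integral_mono y_int mult_left_mono) (auto simp: less_imp_le)
    have \<mu>y_int: "integrable lebesgue (\<lambda>x. \<bar>\<mu> x * y n x\<bar> powr p)"
      and \<mu>y_le: "(LINT x|lebesgue. \<bar>\<mu> x * y n x\<bar> powr p) \<le> K" for n
    proof -
      have *: "integrable lebesgue (\<lambda>x. \<bar>\<mu> x * y n x\<bar> powr p) \<and>
          (LINT x|lebesgue. \<bar>\<mu> x * y n x\<bar> powr p) \<le> c powr p * (LINT x|lebesgue. \<bar>\<theta> x * gn n x\<bar> powr p)"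
        unfolding y_def by (rule c(2)[where n = "real n", OF gn_mem]) (rule gn_supp)
      show "integrable lebesgue (\<lambda>x. \<bar>\<mu> x * y n x\<bar> powr p)" using * by blast
      have "(LINT x|lebesgue. \<bar>\<theta> x * gn n x\<bar> powr p) \<le> (LINT x|lebesgue. \<bar>\<theta> x * g x\<bar> powr p)"
        by (intro integral_mono gn_int g_int gn_powr)
      then have "c powr p * (LINT x|lebesgue. \<bar>\<theta> x * gn n x\<bar> powr p) \<le> K"
        unfolding K_def by (intro mult_left_mono) auto
      with * show "(LINT x|lebesgue. \<bar>\<mu> x * y n x\<bar> powr p) \<le> K" by linarith
    qed
    have y_meas: "y n \<in> borel_measurable lebesgue" for n
      unfolding y_def[abs_def] by (rule green_integral_measurable[OF gn_loc y_int])
    have y_ennreal: "ennreal (y n x) = (\<integral>\<^sup>+t. ennreal (green x t * gn n t) \<partial>lebesgue)" for n x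
      unfolding y_def using gn0 green_pos[of x]
      by (intro nn_integral_eq_integral[symmetric] y_int) (simp add: less_imp_le)
    have prod_meas: "(\<lambda>t. green x t * h t) \<in> borel_measurable lebesgue" if "h \<in> borel_measurable lebesgue" for h x
      by (intro borel_measurable_times green_measurable that)
    have sup: "(SUP n. ennreal (y n x)) = (\<integral>\<^sup>+t. ennreal (green x t * g t) \<partial>lebesgue)" for x
    proof -
      have inc: "incseq (\<lambda>n t. ennreal (green x t * gn n t))"
        using gn_mono green_pos[of x] by (auto simp: incseq_def le_fun_def less_imp_le intro!: ennreal_leI mult_left_mono)
      have "(SUP n. ennreal (green x t * gn n t)) = ennreal (green x t * g t)" for t
      proof (rule LIMSEQ_unique[OF LIMSEQ_SUP])
        show "incseq (\<lambda>n. ennreal (green x t * gn n t))"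
          using inc by (auto simp: incseq_def le_fun_def)
        show "(\<lambda>n. ennreal (green x t * gn n t)) \<longlonglongrightarrow> ennreal (green x t * g t)"
          by (intro tendsto_ennrealI tendsto_intros gn_lim)
      qed
      then show ?thesis
        unfolding y_ennreal
        using nn_integral_monotone_convergence_SUP[OF inc] prod_meas[OF gn_meas] by simp
    qed
    have "\<exists>x. (\<integral>\<^sup>+t. ennreal (green x t * g t) \<partial>lebesgue) < \<infinity>"
    proof (rule ccontr)
      assume "\<not> ?thesis"
      then have inf: "(SUP n. ennreal (y n x)) = \<infinity>" for x
        unfolding sup by (simp add: less_top[symmetric])
      \<comment> \<open>On a set of finite measure, \<open>s \<le> 1 + s powr p\<close> for
        nonnegative \<open>s\<close> turns the bound on p-th powers into one on the integral of the
        function itself, which monotone convergence would carry to an infinite limit. Any interval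
        of finite positive length would do.\<close>
      define h where "h n x = ennreal (\<mu> x) * indicator {0..1} x * ennreal (y n x)" for n x
      have h_SUP: "(SUP n. h n x) = \<infinity> * indicator {0..1} x" for x
        unfolding h_def SUP_mult_left_ennreal[symmetric] inf
        using \<mu>_pos[of x] by (auto simp: indicator_def ennreal_mult_top)
      have h_inc: "incseq h"
        using y_mono by (auto simp: incseq_def le_fun_def h_def intro!: mult_left_mono ennreal_leI)
      have h_meas: "h n \<in> borel_measurable lebesgue" for n
        unfolding h_def[abs_def]
        by (intro borel_measurable_times_ennreal borel_measurable_indicator
             measurable_compose[OF _ measurable_ennreal] y_meas \<mu>_measurable) auto
      have h_le: "(\<integral>\<^sup>+x. h n x \<partial>lebesgue) \<le> 1 + ennreal K" for n
      proof -
        have "h n x \<le> indicator {0..1} x + ennreal (\<bar>\<mu> x * y n x\<bar> powr p)" for x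
        proof (cases "x \<in> {0..1}")
          case True
          have "\<mu> x * y n x \<le> 1 + \<bar>\<mu> x * y n x\<bar> powr p"
          proof (cases "\<bar>\<mu> x * y n x\<bar> \<le> 1")
            case True
            then show ?thesis by (auto intro: add_increasing2)
          next
            case False
            then have "\<bar>\<mu> x * y n x\<bar> powr 1 \<le> \<bar>\<mu> x * y n x\<bar> powr p"
              using p_ge_1 by (intro powr_mono) auto
            with False show ?thesis by simp
          qed
          then have "ennreal (\<mu> x * y n x) \<le> ennreal (1 + \<bar>\<mu> x * y n x\<bar> powr p)"
            by (rule ennreal_leI)
          also have "\<dots> = 1 + ennreal (\<bar>\<mu> x * y n x\<bar> powr p)"
            by (subst ennreal_plus) auto
          finally show ?thesis
            using True y0[of n x] \<mu>_pos[of x] by (simp add: h_def ennreal_mult)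
        qed (simp add: h_def)
        then have "(\<integral>\<^sup>+x. h n x \<partial>lebesgue)
            \<le> (\<integral>\<^sup>+x. indicator {0..1::real} x + ennreal (\<bar>\<mu> x * y n x\<bar> powr p) \<partial>lebesgue)"
          by (rule nn_integral_mono)
        also have "\<dots> = (\<integral>\<^sup>+x. indicator {0..1::real} x \<partial>lebesgue)
            + (\<integral>\<^sup>+x. ennreal (\<bar>\<mu> x * y n x\<bar> powr p) \<partial>lebesgue)"
          using borel_measurable_integrable[OF \<mu>y_int]
          by (intro nn_integral_add borel_measurable_indicator measurable_compose[OF _ measurable_ennreal]) auto
        also have "(\<integral>\<^sup>+x. ennreal (\<bar>\<mu> x * y n x\<bar> powr p) \<partial>lebesgue) \<le> ennreal K"
          by (subst nn_integral_eq_integral[OF \<mu>y_int]) (auto intro: ennreal_leI \<mu>y_le)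
        finally show ?thesis by simp
      qed
      have "\<infinity> = (\<integral>\<^sup>+x. \<infinity> * indicator {0..1::real} x \<partial>lebesgue)"
        by (subst nn_integral_cmult_indicator) auto
      also have "\<dots> = (SUP n. \<integral>\<^sup>+x. h n x \<partial>lebesgue)"
        unfolding h_SUP[symmetric] by (rule nn_integral_monotone_convergence_SUP[OF h_inc h_meas])
      also have "\<dots> \<le> 1 + ennreal K"
        by (rule SUP_least[OF h_le])
      finally show False by (simp add: top_unique)
    qed
    then obtain x\<^sub>0 where "(\<integral>\<^sup>+t. ennreal (green x\<^sub>0 t * g t) \<partial>lebesgue) < \<infinity>" by blast
    then have x\<^sub>0: "integrable lebesgue (\<lambda>t. green x\<^sub>0 t * g t)"
      using g0 green_pos[of x\<^sub>0] by (intro integrableI_nonneg prod_meas g_meas) (auto simp: less_imp_le)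
    note int = integrable_green[OF gloc x\<^sub>0]
    \<comment> \<open>With integrability secured, the full integrand dominates its truncations, and
      the limits become limits of real numbers, as Fatou's lemma in \<open>x\<close> needs
      them.\<close>
    have "(\<lambda>n. y n x) \<longlonglongrightarrow> (LINT t|lebesgue. green x t * g t)" for x
      unfolding y_def
    proof (rule integral_dominated_convergence[OF prod_meas[OF g_meas] prod_meas[OF gn_meas] int[of x]])
      show "AE t in lebesgue. (\<lambda>n. green x t * gn n t) \<longlonglongrightarrow> green x t * g t"
        by (intro AE_I2 tendsto_intros gn_lim)
      show "AE t in lebesgue. norm (green x t * gn n t) \<le> green x t * g t" for n
        using gn0 gn_le green_pos[of x] by (auto simp: abs_mult less_imp_le)
    qed
    then have "(\<lambda>n. \<bar>\<mu> x * y n x\<bar> powr p) \<longlonglongrightarrow> \<bar>\<mu> x * (LINT t|lebesgue. green x t * g t)\<bar> powr p" for x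
      using p_ge_1 by (intro tendsto_powr' tendsto_rabs tendsto_mult tendsto_const) auto
    from integrable_limit_of_bounded_integrals[OF \<mu>y_int _ this \<mu>y_le]
    show "(\<forall>x. integrable lebesgue (\<lambda>t. green x t * g t)) \<and>
      integrable lebesgue (\<lambda>x. \<bar>\<mu> x * (LINT t|lebesgue. green x t * g t)\<bar> powr p) \<and>
      (LINT x|lebesgue. \<bar>\<mu> x * (LINT t|lebesgue. green x t * g t)\<bar> powr p)
        \<le> c powr p * (LINT x|lebesgue. \<bar>\<theta> x * g x\<bar> powr p)"
      using int by (simp add: K_def)
  qed
qed

text \<open>Positivity of the kernel reduces the general case to nonnegative data: the Green
  integral of \<open>k\<close> is dominated by that of its absolute value, which has the same
  weighted norm. Convergence at every point and the bound with the same \<open>c\<close>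
  follow.\<close>

lemma admissible_imp_bounded:
  assumes \<theta>: "continuous_on UNIV \<theta>" "\<And>x. \<theta> x > 0" and adm: "admissible p \<mu> \<theta> q"
  shows "green_operator_bounded p \<mu> \<theta> green"
proof -
  obtain c where c: "c > 0"
    "\<And>g. \<lbrakk>g \<in> Lp_weighted p \<theta>; \<And>t. 0 \<le> g t\<rbrakk> \<Longrightarrow>
      (\<forall>x. integrable lebesgue (\<lambda>t. green x t * g t)) \<and>
      integrable lebesgue (\<lambda>x. \<bar>\<mu> x * (LINT t|lebesgue. green x t * g t)\<bar> powr p) \<and>
      (LINT x|lebesgue. \<bar>\<mu> x * (LINT t|lebesgue. green x t * g t)\<bar> powr p)
        \<le> c powr p * (LINT x|lebesgue. \<bar>\<theta> x * g x\<bar> powr p)"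
    using admissible_imp_green_bound[OF \<theta> adm] by blast
  have "(\<forall>x. integrable lebesgue (\<lambda>t. green x t / \<theta> t * f t)) \<and>
      green_operator \<mu> \<theta> green f \<in> Lp p \<and>
      Lp_norm p (green_operator \<mu> \<theta> green f) \<le> c * Lp_norm p f" if f: "f \<in> Lp p" for f
  proof -
    define k where "k t = f t / \<theta> t" for t
    define Y where "Y x = (LINT t|lebesgue. green x t * \<bar>k t\<bar>)" for x
    define Z where "Z x = (LINT t|lebesgue. green x t * k t)" for x
    have k_meas: "k \<in> borel_measurable lebesgue"
      using f continuous_on_imp_borel_measurable_lebesgue[OF \<theta>(1)]
      unfolding k_def[abs_def] by (auto simp: Lp_def intro: borel_measurable_divide)
    have \<theta>k: "\<bar>\<theta> x * k x\<bar> = \<bar>f x\<bar>" "\<bar>\<theta> x * \<bar>k x\<bar>\<bar> = \<bar>f x\<bar>" for x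
      using \<theta>(2)[of x] by (auto simp: k_def abs_mult)
    have mem: "k \<in> Lp_weighted p \<theta>" "(\<lambda>t. \<bar>k t\<bar>) \<in> Lp_weighted p \<theta>"
      using f k_meas p_ge_1 by (auto simp: mem_Lp_weighted_iff[OF \<theta>] Lp_def \<theta>k)
    have k_loc: "k absolutely_integrable_on {a..b}" for a b
      using mem(1) p_ge_1 by (auto simp: Lp_weighted_def intro: Lp_loc_imp_absolutely_integrable)
    note * = c(2)[OF mem(2), simplified \<theta>k, simplified, folded Y_def]
    have int: "integrable lebesgue (\<lambda>t. green x t * k t)" for x
    proof (rule Bochner_Integration.integrable_bound)
      show "integrable lebesgue (\<lambda>t. green x t * \<bar>k t\<bar>)" using * by blast
    qed (auto simp: abs_mult intro: borel_measurable_times green_measurable k_meas)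
    have eq: "green x t / \<theta> t * f t = green x t * k t" for x t
      by (simp add: k_def)
    have op: "green_operator \<mu> \<theta> green f = (\<lambda>x. \<mu> x * Z x)"
      by (simp only: fun_eq_iff green_operator_def eq Z_def simp_thms)
    have Z_meas: "Z \<in> borel_measurable lebesgue"
      unfolding Z_def[abs_def] by (rule green_integral_measurable[OF k_loc int])
    have "\<bar>Z x\<bar> \<le> Y x" for x
      using integral_norm_bound[of lebesgue "\<lambda>t. green x t * k t"] green_pos[of x]
      by (simp add: Z_def Y_def abs_mult less_imp_le)
    then have le: "\<bar>\<mu> x * Z x\<bar> powr p \<le> \<bar>\<mu> x * Y x\<bar> powr p" for x
      using p_ge_1 \<mu>_pos[of x]
      by (intro powr_mono2) (auto simp: abs_mult intro!: mult_left_mono intro: order_trans[OF _ abs_ge_self])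
    have Y_int: "integrable lebesgue (\<lambda>x. \<bar>\<mu> x * Y x\<bar> powr p)" using * by blast
    have Z_int: "integrable lebesgue (\<lambda>x. \<bar>\<mu> x * Z x\<bar> powr p)"
      using Y_int
    proof (rule Bochner_Integration.integrable_bound)
      show "(\<lambda>x. \<bar>\<mu> x * Z x\<bar> powr p) \<in> borel_measurable lebesgue"
        by (intro measurable_abs_powr borel_measurable_times \<mu>_measurable Z_meas)
    qed (use le in auto)
    have "(LINT x|lebesgue. \<bar>\<mu> x * Z x\<bar> powr p) \<le> (LINT x|lebesgue. \<bar>\<mu> x * Y x\<bar> powr p)"
      by (intro integral_mono Z_int Y_int le)
    also have "\<dots> \<le> c powr p * (LINT x|lebesgue. \<bar>f x\<bar> powr p)"
      using * by blast
    finally have "Lp_norm p (\<lambda>x. \<mu> x * Z x) \<le> c * Lp_norm p f"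
      unfolding Lp_norm_def using c(1) p_ge_1
      by (subst root_le_mult_root_iff) (auto intro: Bochner_Integration.integral_nonneg)
    moreover have "(\<lambda>x. \<mu> x * Z x) \<in> Lp p"
      using Z_int Z_meas \<mu>_measurable by (auto simp: Lp_def intro: borel_measurable_times)
    ultimately show ?thesis
      unfolding op eq using int by blast
  qed
  then show ?thesis
    unfolding green_operator_bounded_def by blast
qed

end

theorem theorem4p3:
  fixes q \<mu> \<theta> :: "real \<Rightarrow> real" and G :: "real \<Rightarrow> real \<Rightarrow> real" and p :: real
  assumes "q \<in> L1_loc" and "AE x in lebesgue. 0 \<le> q x"
    and "\<And>x. (\<integral>\<^sup>+ t\<in>{..x}. ennreal (q t) \<partial>lebesgue) > 0"
    and "\<And>x. (\<integral>\<^sup>+ t\<in>{x..}. ennreal (q t) \<partial>lebesgue) > 0"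
    and "continuous_on UNIV \<mu>" and "\<And>x. \<mu> x > 0"
    and "continuous_on UNIV \<theta>" and "\<And>x. \<theta> x > 0"
    and "1 \<le> p"
    and "(\<integral>\<^sup>+ t\<in>{..0}. ennreal (\<mu> t) \<partial>lebesgue) = \<infinity>"
    and "(\<integral>\<^sup>+ t\<in>{0..}. ennreal (\<mu> t) \<partial>lebesgue) = \<infinity>"
    and "is_green_function q G"
  shows "admissible p \<mu> \<theta> q \<longleftrightarrow> green_operator_bounded p \<mu> \<theta> G"
proof -
  obtain u v where system: "principal_system q u v"
    and G: "G = (\<lambda>x t. if x \<ge> t then u x * v t else u t * v x)"
    using \<open>is_green_function q G\<close> by (auto simp: is_green_function_def)
  \<comment> \<open>The system is the one that defines \<open>G\<close>, so the kernel of the locale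
    agrees with \<open>G\<close> by definition.\<close>
  interpret weighted_principal_solutions q u v \<mu> p
    by unfold_locales (use assms system in auto)
  have "G = green"
    by (simp add: G green_def)
  then show ?thesis
    using admissible_imp_bounded bounded_imp_admissible assms(7,8) by blast
qed

end
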